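(* Let $X\subset\mathbb{C}$ be an unshielded continuum with more than one point. Then, for every $\theta$, the impression $Imp(\theta)$ is contained in a fiber $F_w^*$ of $X$ for some $w\in Imp(\theta)$.
   Context: A continuum is a nonempty compact connected metric space. $X$ is unshielded if $X=\partial U_\infty$, where $U_\infty$ is the unbounded component of $\mathbb{C}\setminus X$. Let $\hat{\mathbb{C}}=\mathbb{C}\cup\{\infty\}$, let $\mathbb{D}=\{z\in\hat{\mathbb{C}}:|z|\leq 1\}$ be the closed unit disk, and regard $U_\infty$ as containing the point $\infty$. By the Riemann Mapping Theorem there is a conformal isomorphism $\Phi:\hat{\mathbb{C}}\setminus\mathbb{D}\to U_\infty$ that fixes $\infty$ and has positive derivative at $\infty$. For an angle $\theta$ (a point $e^{\mathbf{i}\theta}$ of $S^1=\partial\mathbb{D}$), the impression of $\theta$ is $$Imp(\theta)=\left\{w\in X:\ \exists\, z_n\in\hat{\mathbb{C}}\setminus\mathbb{D}\ \text{with}\ z_n\to e^{\mathbf{i}\theta},\ \lim_{n\to\infty}\Phi(z_n)=w\right\}.$$ $X^o$ and $\partial X$ denote the interior and boundary of $X$ in $\mathbb{C}$. A point $x\in\partial X$ is separated from a point $y\in\partial X$ by a subset $C\subset X$ if there is a separation $\partial X\setminus C=A\cup B$, i.e. a decomposition with $\overline{A}\cap B=A\cap\overline{B}=\emptyset$, such that $x\in A$ and $y\in B$. The modified pseudo-fiber $E_x^*$ of $X$ at $x$ is: $E_x^*=\{x\}$ if $x\in X^o$; and, if $x\in\partial X$, $E_x^*$ is the set of points $y\in\partial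 X$ that cannot be separated from $x$ by any finite set $C\subset\partial X$. The (modified) fiber $F_x^*$ of $X$ at $x$ is the connected component of $E_x^*$ containing $x$. *)

theory Defs
  imports "HOL-Analysis.Analysis"
begin

definition continuum :: "'a::metric_space set \<Rightarrow> bool" where
  "continuum X \<longleftrightarrow> X \<noteq> {} \<and> compact X \<and> connected X"

text \<open>
  For compact \<open>X \<subseteq> \<complex>\<close>, the library set \<open>outside X\<close> (the points of the complement whose
  component in the complement is unbounded) is the unbounded component of the complement.
\<close>

definition unshielded :: "complex set \<Rightarrow> bool" where
  "unshielded X \<longleftrightarrow> X = frontier (outside X)"

text \<open>The extended plane: \<open>None\<close> is the point at infinity, \<open>Some z\<close> the finite point \<open>z\<close>.\<close>

type_synonym ext_complex = "complex option"

abbreviation ext_topology :: "ext_complex topology" where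
  "ext_topology \<equiv> Alexandroff_compactification (euclidean :: complex topology)"

definition ext_disc_exterior :: "ext_complex set" where
  "ext_disc_exterior = insert None (Some ` {z. 1 < norm z})"

definition ext_outside :: "complex set \<Rightarrow> ext_complex set" where
  "ext_outside X = insert None (Some ` outside X)"

text \<open>
  The chart \<open>1/z\<close> at infinity and its inverse. The value \<open>inf_chart (Some 0) = 0\<close> is junk:
  \<open>Some 0\<close> lies outside the domain of the chart.
\<close>

definition inf_chart :: "ext_complex \<Rightarrow> complex" where
  "inf_chart p = (case p of None \<Rightarrow> 0 | Some z \<Rightarrow> inverse z)"

definition inf_param :: "complex \<Rightarrow> ext_complex" where
  "inf_param \<zeta> = (if \<zeta> = 0 then None else Some (inverse \<zeta>))"

text \<open>
  A conformal isomorphism from the exterior of the closed unit disc onto the unbounded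
  complementary domain of \<open>X\<close> (both containing infinity) that fixes infinity and has positive
  derivative there. Holomorphy is expressed in charts: as \<open>\<Phi>\<close> is injective and fixes infinity, it
  maps finite points to finite points, so \<open>the\<close> is never applied to \<open>None\<close> below. Near infinity
  both sides are read in the chart \<open>1/z\<close>; complex differentiability at \<open>0\<close> of the resulting
  function, which is holomorphic on a punctured neighbourhood of \<open>0\<close>, is holomorphy at infinity.
  The derivative of \<open>\<Phi>\<close> at infinity is taken in this chart; it is the reciprocal of the limit of
  \<open>\<Phi>(z)/z\<close>, so that its positivity means the same under either convention.
\<close>

definition exterior_riemann_map :: "complex set \<Rightarrow> (ext_complex \<Rightarrow> ext_complex) \<Rightarrow> bool" where
  "exterior_riemann_map X \<Phi> \<longleftrightarrow>
     bij_betw \<Phi> ext_disc_exterior (ext_outside X) \<and>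
     \<Phi> None = None \<and>
     (\<lambda>z. the (\<Phi> (Some z))) holomorphic_on {z. 1 < norm z} \<and>
     (\<exists>c::real. 0 < c \<and>
        ((\<lambda>\<zeta>. inf_chart (\<Phi> (inf_param \<zeta>))) has_field_derivative complex_of_real c) (at 0))"

definition impression ::
  "complex set \<Rightarrow> (ext_complex \<Rightarrow> ext_complex) \<Rightarrow> real \<Rightarrow> complex set" where
  "impression X \<Phi> \<theta> =
     {w \<in> X. \<exists>z :: nat \<Rightarrow> ext_complex.
        (\<forall>n. z n \<in> ext_disc_exterior) \<and>
        limitin ext_topology z (Some (cis \<theta>)) sequentially \<and>
        limitin ext_topology (\<lambda>n. \<Phi> (z n)) (Some w) sequentially}"

definition separated_by :: "complex set \<Rightarrow> complex set \<Rightarrow> complex \<Rightarrow> complex \<Rightarrow> bool" where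
  "separated_by X C x y \<longleftrightarrow>
     (\<exists>A B. frontier X - C = A \<union> B \<and> closure A \<inter> B = {} \<and> A \<inter> closure B = {} \<and>
            x \<in> A \<and> y \<in> B)"

text \<open>The next two notions are meant for \<open>x \<in> X\<close> with \<open>X\<close> closed.\<close>

definition pseudo_fiber :: "complex set \<Rightarrow> complex \<Rightarrow> complex set" where
  "pseudo_fiber X x =
     (if x \<in> interior X then {x}
      else {y \<in> frontier X. \<not> (\<exists>C. finite C \<and> C \<subseteq> frontier X \<and> separated_by X C x y)})"

definition fiber :: "complex set \<Rightarrow> complex \<Rightarrow> complex set" where
  "fiber X x = connected_component_set (pseudo_fiber X x) x"

end

theory Submission
  imports Defs "HOL-Complex_Analysis.Conformal_Mappings"
begin

text \<open>
  Write \<open>U\<close> for the unbounded complementary domain of \<open>X\<close>, \<open>F\<close> for the Riemann map restricted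
  to finite points, \<open>c\<close> for the point of the unit circle at the given angle, and \<open>I\<close> for the
  impression of \<open>c\<close>. Two facts about arbitrarily small circular crosscuts at \<open>c\<close> decide the
  theorem.

  By the length-area method some of them have images of arbitrarily small diameter, for the images
  of all of them fill a region of finite area (lemma \<open>short_crosscuts\<close>, from
  \<open>area_integral_finite\<close> and the Cauchy-Schwarz inequality). A subsequence of these images
  shrinks to a single point \<open>w\<close>, a principal point, which lies in \<open>I\<close>.

  The point \<open>w\<close> cannot be separated by a finite set from any \<open>y\<close> in \<open>I\<close> (lemma
  \<open>not_separated_from_principal_point\<close>). Suppose that \<open>X - C\<close> splits into \<open>A\<close> containing
  \<open>w\<close> and \<open>B\<close> containing \<open>y\<close>, where \<open>C\<close> is finite. Choose a closed disc \<open>K\<close> about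
  \<open>w\<close> disjoint from \<open>B \<union> C\<close> and not containing \<open>y\<close>, and put \<open>P = A \<union> C \<union> K\<close> and
  \<open>Q = B \<union> C\<close>. These are compact sets with \<open>P \<inter> Q = C\<close> and \<open>P \<union> Q = X \<union> K\<close>. Since the
  image of every neighbourhood of \<open>c\<close> comes close to \<open>y\<close>, there are infinitely many points of
  \<open>U\<close> near \<open>y\<close> such that between any two of them runs one of the crosscuts whose image lies
  in \<open>K\<close>. No two of them are separated by \<open>P\<close>, because they lie in a disc about \<open>y\<close> missing
  \<open>P\<close>; no two are separated by \<open>Q\<close>, because \<open>U\<close> is connected and misses \<open>Q\<close>; and yet
  any two are separated by \<open>P \<union> Q\<close>. This contradicts a form of Janiszewski's theorem: if
  \<open>P \<inter> Q\<close> is finite, then \<open>P \<union> Q\<close> can separate only finitely many points that neither \<open>P\<close>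
  nor \<open>Q\<close> separates (theorem \<open>finite_intersection_separates_finitely_many\<close>).

  Hence \<open>I\<close> is contained in the pseudo-fiber of \<open>w\<close>. As \<open>I\<close> is connected, being a decreasing
  intersection of connected compact sets, it lies in the component of \<open>w\<close>, which is the fiber.
\<close>

section \<open>Compact plane sets with finite intersection\<close>

text \<open>
  More vectors than coordinates are linearly dependent over the integers. Gaussian elimination of
  one coordinate at a time proves it without passing to the rationals.
\<close>
lemma integer_relation_of_infinite_family:
  fixes m :: "'i \<Rightarrow> 'c \<Rightarrow> int"
  assumes "finite C" "infinite I"
  shows "\<exists>F n. finite F \<and> F \<subseteq> I \<and> (\<exists>i\<in>F. n i \<noteq> 0) \<and> (\<forall>c\<in>C. (\<Sum>i\<in>F. n i * m i c) = (0::int))"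
  using assms
proof (induction C arbitrary: m I rule: finite_induct)
  case empty
  then obtain i where "i \<in> I" by (metis finite.emptyI ex_in_conv)
  then show ?case by (intro exI[of _ "{i}"] exI[of _ "\<lambda>_. 1"]) auto
next
  case (insert c C)
  show ?case
  proof (cases "\<forall>i\<in>I. m i c = 0")
    case True
    obtain F n where F: "finite F" "F \<subseteq> I" "\<exists>i\<in>F. n i \<noteq> 0" "\<forall>d\<in>C. (\<Sum>i\<in>F. n i * m i d) = 0"
      using insert.IH[OF insert.prems, of m] by blast
    moreover have "(\<Sum>i\<in>F. n i * m i c) = 0"
      using True F(2) by (intro sum.neutral) auto
    ultimately show ?thesis by (intro exI[of _ F] exI[of _ n]) auto
  next
    case False
    then obtain k where k: "k \<in> I" "m k c \<noteq> 0" by blast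
    \<comment> \<open>The vectors \<open>m k c * m i - m i c * m k\<close> have coordinate 0 at \<open>c\<close>; a relation among their
      other coordinates turns into a relation of the original vectors that may involve \<open>m k\<close>.\<close>
    obtain F n where F: "finite F" "F \<subseteq> I - {k}" "\<exists>i\<in>F. n i \<noteq> 0"
        "\<forall>d\<in>C. (\<Sum>i\<in>F. n i * (m k c * m i d - m i c * m k d)) = 0"
      using insert.IH[of "I - {k}" "\<lambda>i d. m k c * m i d - m i c * m k d"] insert.prems
      by (auto simp: infinite_remove)
    define n' where "n' i = (if i = k then - (\<Sum>j\<in>F. n j * m j c) else n i * m k c)" for i
    have kF: "k \<notin> F" using F(2) by blast
    have *: "(\<Sum>i\<in>insert k F. n' i * m i d) = (\<Sum>i\<in>F. n i * (m k c * m i d - m i c * m k d))" for d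
    proof -
      have "(\<Sum>i\<in>F. n' i * m i d) = (\<Sum>i\<in>F. n i * m k c * m i d)"
        using kF by (intro sum.cong) (auto simp: n'_def)
      then show ?thesis
        using kF F(1)
        by (simp add: n'_def sum_distrib_left sum_subtractf algebra_simps)
    qed
    have "\<forall>d\<in>insert c C. (\<Sum>i\<in>insert k F. n' i * m i d) = 0"
      using F(4) unfolding * by (auto simp: algebra_simps)
    moreover have "\<exists>i\<in>insert k F. n' i \<noteq> 0"
      using F(3) kF k(2) by (auto simp: n'_def)
    ultimately show ?thesis
      using F(1,2) k(1) by (intro exI[of _ "insert k F"] exI[of _ n']) auto
  qed
qed

text \<open>
  A continuous logarithm would have to increase by \<open>2 * pi * n * \<i>\<close> along one turn of the circle:
  its difference from \<open>n * \<i> * t\<close> takes values in a discrete set, hence is constant.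
\<close>
lemma no_continuous_log_of_power_on_circle:
  fixes h :: "complex \<Rightarrow> complex"
  assumes "n \<noteq> 0" "0 < R" and h: "continuous_on (sphere a R) h"
    and eq: "\<And>z. z \<in> sphere a R \<Longrightarrow> (z - a) powi n = exp (h z)"
  shows False
proof -
  define \<phi> where "\<phi> t = h (a + of_real R * cis t) - \<i> * of_int n * of_real t" for t :: real
  have sph: "a + of_real R * cis t \<in> sphere a R" for t
    using \<open>0 < R\<close> by (simp add: dist_norm norm_mult)
  have cont: "continuous_on {0..2*pi} \<phi>"
    unfolding \<phi>_def using sph
    by (intro continuous_intros continuous_on_compose2[OF h]) auto
  have exp\<phi>: "exp (\<phi> t) = of_real R powi n" for t
  proof -
    have "exp (\<i> * of_int n * of_real t) = cis t powi n"
      by (simp add: cis_conv_exp exp_power_int mult_ac)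
    moreover have "exp (h (a + of_real R * cis t)) = of_real R powi n * cis t powi n"
      using eq[OF sph, of t] by (simp add: power_int_mult_distrib)
    ultimately show ?thesis by (simp add: \<phi>_def exp_diff power_int_eq_0_iff)
  qed
  have "\<phi> constant_on {0..2*pi}"
  proof (rule continuous_discrete_range_constant[OF _ cont])
    fix x
    have "2 * pi \<le> norm (\<phi> y - \<phi> x)" if "\<phi> y \<noteq> \<phi> x" for y
    proof -
      have "exp (\<phi> y) = exp (\<phi> x)" by (simp add: exp\<phi>)
      then obtain k :: int where k: "\<phi> y = \<phi> x + of_int (2*k) * pi * \<i>"
        using exp_eq[of "\<phi> y" "\<phi> x"] by auto
      with that have "k \<noteq> 0" by auto
      then have "1 \<le> \<bar>real_of_int k\<bar>" by linarith
      then have "2 * pi * 1 \<le> 2 * pi * \<bar>real_of_int k\<bar>" by (intro mult_left_mono) auto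
      also have "\<dots> = norm (\<phi> y - \<phi> x)" by (simp add: k norm_mult)
      finally show ?thesis by simp
    qed
    then show "\<exists>e>0. \<forall>y. y \<in> {0..2*pi} \<and> \<phi> y \<noteq> \<phi> x \<longrightarrow> e \<le> norm (\<phi> y - \<phi> x)"
      by (intro exI[of _ "2*pi"]) auto
  qed auto
  then have "\<phi> 0 = \<phi> (2*pi)" unfolding constant_on_def by force
  then show False using \<open>n \<noteq> 0\<close> by (simp add: \<phi>_def)
qed

text \<open>
  Borsuk's criterion: moving \<open>a\<close> to \<open>b\<close> inside the complement of \<open>S\<close> deforms the quotient
  to the constant 1 through maps into the punctured plane. The criterion gives the argument, as the
  logarithm of the quotient normalised to modulus 1; the logarithm of the modulus is added to it.
\<close>
lemma continuous_log_of_quotient: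
  fixes a b :: complex
  assumes "compact S" "connected_component (- S) a b"
  obtains g where "continuous_on S g" "\<And>x. x \<in> S \<Longrightarrow> exp (g x) = (x - a) / (x - b)"
proof -
  have ab: "a \<notin> S" "b \<notin> S" using assms(2) connected_component_in by blast+
  have "homotopic_with_canon (\<lambda>x. True) S (sphere 0 1)
          (\<lambda>x. (x - a) /\<^sub>R norm (x - a)) (\<lambda>x. (x - b) /\<^sub>R norm (x - b))"
    using Borsuk_maps_homotopic_in_connected_component_eq[OF assms(1) ab] assms(2) by simp
  then obtain g where g: "continuous_on S g"
      "\<And>x. x \<in> S \<Longrightarrow> exp (\<i> * of_real (g x)) = (x - a) /\<^sub>R cmod (x - a) / ((x - b) /\<^sub>R cmod (x - b))"
    apply (subst (asm) homotopic_circlemaps_divide)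
    apply (auto simp: inessential_eq_continuous_logarithm_circle)
    done
  show thesis
  proof
    show "continuous_on S (\<lambda>x. \<i> * of_real (g x) + of_real (ln (norm (x - a)) - ln (norm (x - b))))"
      using ab by (intro continuous_intros g(1)) auto
    fix x assume x: "x \<in> S"
    then have nz: "x \<noteq> a" "x \<noteq> b" using ab by auto
    have "exp (complex_of_real (ln (norm (x - a)) - ln (norm (x - b)))) = of_real (norm (x - a) / norm (x - b))"
      unfolding exp_of_real using nz by (simp add: exp_diff)
    then show "exp (\<i> * of_real (g x) + of_real (ln (norm (x - a)) - ln (norm (x - b)))) = (x - a) / (x - b)"
      using nz unfolding exp_add g(2)[OF x] by (simp add: scaleR_conv_of_real field_simps)
  qed
qed

text \<open>
  The quotients \<open>(z - v i) / (z - v 0)\<close> have continuous logarithms on \<open>P\<close> and on \<open>Q\<close>, which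
  differ on \<open>P \<inter> Q\<close> by integer multiples of \<open>2 * pi * \<i>\<close>. As \<open>P \<inter> Q\<close> is finite, some
  nontrivial integer combination makes the differences vanish, so that the corresponding product
  of powers of quotients has a continuous logarithm on all of \<open>P \<union> Q\<close>. If a point \<open>v k\<close> that
  occurs with exponent \<open>n k \<noteq> 0\<close> were alone in its bounded complementary component \<open>G\<close>, then
  this logarithm, extended over \<open>closure G\<close>, could be used to continue \<open>(z - v k) powi n k\<close> from
  the outside of \<open>G\<close> to a nonvanishing function on the whole plane, which is impossible because
  that function winds around 0 along large circles. This generalises Janiszewski's theorem, in
  which the intersection is connected.
\<close>
theorem finite_intersection_separates_finitely_many:
  fixes v :: "nat \<Rightarrow> complex"
  assumes P: "compact P" and Q: "compact Q" and fin: "finite (P \<inter> Q)"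
    and vP: "\<And>i j. connected_component (- P) (v i) (v j)"
    and vQ: "\<And>i j. connected_component (- Q) (v i) (v j)"
  obtains i j where "i < j" "connected_component (- (P \<union> Q)) (v i) (v j)"
proof (rule ccontr)
  assume "\<not> thesis"
  with that have "\<And>i j. i < j \<Longrightarrow> \<not> connected_component (- (P \<union> Q)) (v i) (v j)" by blast
  then have sep: "\<not> connected_component (- (P \<union> Q)) (v i) (v j)" if "i \<noteq> j" for i j
    using that by (metis connected_component_sym linorder_neqE_nat)
  define S where "S = P \<union> Q"
  define b where "b = v 0"
  have S: "compact S" using P Q by (simp add: S_def compact_Un)
  have vS: "v i \<notin> S" for i
    using vP[of i i] vQ[of i i] connected_component_in unfolding S_def by fastforce
  \<comment> \<open>The component \<open>G\<close> used below must be bounded, and \<open>v 0\<close> is the base point of all quotients.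
    As the points lie in different components, these two demands exclude at most two indices.\<close>
  have "connected (outside S)"
    using S by (intro connected_outside) (auto simp: compact_imp_bounded)
  then have out: "i = j" if "v i \<in> outside S" "v j \<in> outside S" for i j
    using sep[of i j] that outside_no_overlap[of S]
    unfolding S_def[symmetric] connected_component_def by blast
  define I where "I = {i. 0 < i \<and> v i \<in> inside S}"
  have "infinite I"
  proof
    assume "finite I"
    moreover have "finite {i. v i \<in> outside S}"
    proof (cases "\<exists>j. v j \<in> outside S")
      case True
      then obtain j where "v j \<in> outside S" by blast
      then have "{i. v i \<in> outside S} \<subseteq> {j}" using out by blast
      then show ?thesis by (simp add: finite_subset)
    qed auto
    moreover have "UNIV = insert 0 (I \<union> {i. v i \<in> outside S})"
    proof -
      have "i = 0 \<or> i \<in> I \<or> v i \<in> outside S" for i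
        using vS[of i] inside_Un_outside[of S] unfolding I_def mem_Collect_eq
        by (metis ComplI UnE gr0I)
      then show ?thesis by blast
    qed
    ultimately have "finite (UNIV :: nat set)" by (metis finite_Un finite_insert)
    then show False by simp
  qed
  have "\<exists>g. continuous_on P g \<and> (\<forall>x\<in>P. exp (g x) = (x - v i) / (x - b))" for i
    using continuous_log_of_quotient[OF P vP[of i 0]] unfolding b_def by metis
  then obtain g where g: "\<And>i. continuous_on P (g i)"
     "\<And>i x. x \<in> P \<Longrightarrow> exp (g i x) = (x - v i) / (x - b)" by metis
  have "\<exists>h. continuous_on Q h \<and> (\<forall>x\<in>Q. exp (h x) = (x - v i) / (x - b))" for i
    using continuous_log_of_quotient[OF Q vQ[of i 0]] unfolding b_def by metis
  then obtain h where h: "\<And>i. continuous_on Q (h i)"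
     "\<And>i x. x \<in> Q \<Longrightarrow> exp (h i x) = (x - v i) / (x - b)" by metis
  have "\<exists>k::int. g i c = h i c + of_int (2*k) * pi * \<i>" if "c \<in> P \<inter> Q" for i c
    using exp_eq[of "g i c" "h i c"] g(2) h(2) that by auto
  then have "\<forall>i. \<exists>k::complex \<Rightarrow> int. \<forall>c\<in>P \<inter> Q. g i c = h i c + of_int (2 * k c) * pi * \<i>"
    by (intro allI bchoice ballI) blast
  then obtain m :: "nat \<Rightarrow> complex \<Rightarrow> int"
    where m: "\<forall>i. \<forall>c\<in>P \<inter> Q. g i c = h i c + of_int (2 * m i c) * pi * \<i>"
    by (rule choice[THEN exE])
  obtain F n where F: "finite F" "F \<subseteq> I" "\<exists>i\<in>F. n i \<noteq> 0"
     and rel: "\<forall>c\<in>P \<inter> Q. (\<Sum>i\<in>F. n i * m i c) = 0"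
    using integer_relation_of_infinite_family[OF fin \<open>infinite I\<close>, of m] by (elim exE conjE)
  define H where "H z = (if z \<in> P then \<Sum>i\<in>F. of_int (n i) * g i z else \<Sum>i\<in>F. of_int (n i) * h i z)" for z
  have agree: "(\<Sum>i\<in>F. of_int (n i) * g i z) = (\<Sum>i\<in>F. of_int (n i) * h i z)" if "z \<in> P \<inter> Q" for z
  proof -
    have "(\<Sum>i\<in>F. of_int (n i) * g i z) = (\<Sum>i\<in>F. of_int (n i) * h i z) + 2 * pi * \<i> * of_int (\<Sum>i\<in>F. n i * m i z)"
      by (simp add: bspec[OF spec[OF m] that] algebra_simps sum.distrib sum_distrib_left)
    then show ?thesis using bspec[OF rel that] by simp
  qed
  have contH: "continuous_on S H"
    unfolding S_def H_def
    using P Q agree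
    by (intro continuous_on_cases_local continuous_intros g(1) h(1))
       (auto simp: compact_imp_closed closed_subset)
  have expH: "exp (H z) = (\<Prod>i\<in>F. ((z - v i) / (z - b)) powi n i)" if "z \<in> S" for z
  proof -
    have "exp (\<Sum>i\<in>F. of_int (n i) * f i) = (\<Prod>i\<in>F. exp (f i) powi n i)" for f :: "nat \<Rightarrow> complex"
      using F(1) by (simp add: exp_sum exp_power_int)
    then show ?thesis using that g(2) h(2) by (auto simp: H_def S_def)
  qed
  obtain k where k: "k \<in> F" "n k \<noteq> 0" using F(3) by blast
  define a where "a = v k"
  define G where "G = connected_component_set (- S) a"
  have G: "bounded G" "open G" "a \<in> G"
    using k F(2) S vS unfolding G_def a_def I_def inside_def
    by (auto simp: open_connected_component open_Compl compact_imp_closed)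
  have frG: "frontier G \<subseteq> S"
    unfolding G_def using frontier_of_connected_component_subset[of "-S" a] S
    by (metis compact_imp_closed frontier_complement frontier_subset_closed order_trans)
  have clG: "closure G = G \<union> frontier G" using G(2) by (simp add: closure_Un_frontier)
  have notG: "v j \<notin> closure G" if "j \<noteq> k" for j
  proof
    assume "v j \<in> closure G"
    then have "v j \<in> G" using vS frG unfolding clG by blast
    then show False using sep[of k j] that unfolding G_def a_def S_def by simp
  qed
  have "0 \<noteq> k" using k F(2) by (auto simp: I_def)
  then have bG: "b \<notin> closure G" using notG unfolding b_def by blast
  \<comment> \<open>\<open>D\<close> collects all factors except the power of \<open>z - a\<close>; it has neither zeros nor poles on
    \<open>closure G\<close>, because every other point lies in another component.\<close>
  define D where "D z = (\<Prod>j\<in>F-{k}. ((z - v j) / (z - b)) powi n j) * (z - b) powi (- n k)" for z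
  have contD: "continuous_on (closure G) D"
    unfolding D_def using bG notG
    by (intro continuous_intros) auto
  have Dnz: "D z \<noteq> 0" if "z \<in> closure G" for z
    using bG notG that F(1) unfolding D_def by (auto simp: power_int_eq_0_iff)
  have HD: "exp (H z) = (z - a) powi n k * D z" if "z \<in> frontier G" for z
  proof -
    have "z \<noteq> b" using that bG clG by auto
    then show ?thesis
      using expH[of z] frG that k(1) F(1) unfolding D_def
      by (auto simp: prod.remove[of F k] a_def power_int_divide_distrib power_int_minus field_simps)
  qed
  obtain H' where H': "continuous_on UNIV H'" "\<And>z. z \<in> frontier G \<Longrightarrow> H' z = H z"
    using Tietze_unbounded[of "frontier G" H UNIV] continuous_on_subset[OF contH frG] by auto
  define K where "K z = (if z \<in> closure G then exp (H' z) / D z else (z - a) powi n k)" for z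
  have "continuous_on (closure G \<union> - G) K"
    unfolding K_def
  proof (intro continuous_on_cases continuous_intros)
    show "continuous_on (closure G) H'" using H'(1) continuous_on_subset by blast
    show "\<forall>z. z \<in> closure G \<and> \<not> z \<in> closure G \<or> z \<in> - G \<and> z \<in> closure G \<longrightarrow> exp (H' z) / D z = (z - a) powi n k"
      using HD H'(2) Dnz clG by auto
  qed (use G Dnz contD in auto)
  then have contK: "continuous_on UNIV K" using closure_subset[of G]
    by (metis Compl_subset_Compl_iff Un_UNIV_left compl_le_swap2 double_complement sup_commute sup_shunt)
  have "K z \<noteq> 0" for z
    using Dnz G closure_subset[of G] by (auto simp: K_def)
  then obtain L where L: "continuous_on UNIV L" "\<And>z. K z = exp (L z)"
    using continuous_logarithm_on_contractible[OF contK] by auto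
  obtain R where R: "0 < R" "closure G \<subseteq> ball a R"
    using bounded_subset_ballD[of "closure G" a] G(1) by auto
  show False
  proof (rule no_continuous_log_of_power_on_circle[OF k(2) R(1)])
    show "continuous_on (sphere a R) L" using L(1) continuous_on_subset by blast
    show "(z - a) powi n k = exp (L z)" if "z \<in> sphere a R" for z
    proof -
      have "z \<notin> closure G" using that R(2) by auto
      then show ?thesis using L(2)[of z] by (simp add: K_def)
    qed
  qed
qed

section \<open>Finite area and short crosscuts\<close>

text \<open>
  Change of variables takes place in \<open>real^2\<close>, where derivatives have determinants; Fubini's
  theorem takes place in the product of two lines. These mutually inverse isometries transport the
  area formula from the one to the other.
\<close>
definition cplx_of_vec :: "real^2 \<Rightarrow> complex" where
  "cplx_of_vec v = Complex (v$1) (v$2)"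

definition vec_of_cplx :: "complex \<Rightarrow> real^2" where
  "vec_of_cplx z = vector [Re z, Im z]"

lemma vec_of_cplx_inverse [simp]: "cplx_of_vec (vec_of_cplx z) = z"
  by (simp add: cplx_of_vec_def vec_of_cplx_def)

lemma cplx_of_vec_inverse [simp]: "vec_of_cplx (cplx_of_vec v) = v"
  by (simp add: cplx_of_vec_def vec_of_cplx_def vec_eq_iff forall_2)

lemma bounded_linear_cplx_of_vec: "bounded_linear cplx_of_vec"
  unfolding linear_conv_bounded_linear[symmetric]
  by (rule linearI) (simp_all add: cplx_of_vec_def complex_eq_iff)

lemma bounded_linear_vec_of_cplx: "bounded_linear vec_of_cplx"
  unfolding linear_conv_bounded_linear[symmetric]
  by (rule linearI) (simp_all add: vec_of_cplx_def vec_eq_iff forall_2)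

lemma vec_of_cplx_image: "vec_of_cplx ` S = cplx_of_vec -` S"
  by (force simp: image_iff)

lemma abs_det_complex_multiplication:
  "\<bar>det (matrix (\<lambda>h. vec_of_cplx (c * cplx_of_vec h)))\<bar> = (norm c)\<^sup>2"
  by (simp add: det_2 matrix_def vec_of_cplx_def cplx_of_vec_def axis_def cmod_power2)
     (simp add: power2_eq_square)

text \<open>Both measures give every box the product of its side lengths.\<close>
lemma distr_lborel_vec2:
  "distr lborel borel (\<lambda>v::real^2. (v$1, v$2)) = lborel"
proof (rule lborel_eqI[symmetric])
  fix l u :: "real \<times> real"
  assume le: "\<And>b. b \<in> Basis \<Longrightarrow> l \<bullet> b \<le> u \<bullet> b"
  have le': "fst l \<le> fst u" "snd l \<le> snd u"
    using le[of "(1,0)"] le[of "(0,1)"] by (auto simp: Basis_prod_def inner_prod_def)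
  have *: "(\<lambda>v::real^2. (v$1, v$2)) -` box l u = box (vector [fst l, snd l]) (vector [fst u, snd u])"
    by (auto simp: mem_box_cart forall_2 mem_box Basis_prod_def inner_prod_def)
  have "(\<lambda>v::real^2. (v$1, v$2)) \<in> borel_measurable borel"
    by (intro borel_measurable_continuous_onI continuous_intros)
  then have "emeasure (distr lborel borel (\<lambda>v::real^2. (v$1, v$2))) (box l u)
      = emeasure lborel (box (vector [fst l, snd l]) (vector [fst u, snd u] :: real^2))"
    by (subst emeasure_distr) (auto simp: * )
  also have "\<dots> = (\<Prod>b\<in>Basis. (u - l) \<bullet> b)"
    using le' by (subst emeasure_lborel_box)
      (auto simp: Basis_vec_def Basis_prod_def inner_prod_def UNIV_2 inner_axis axis_eq_axis prod.insert_if)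
  finally show "emeasure (distr lborel borel (\<lambda>v::real^2. (v$1, v$2))) (box l u) = (\<Prod>b\<in>Basis. (u - l) \<bullet> b)" .
qed simp

text \<open>
  The squared modulus of the derivative is the Jacobian determinant of \<open>f\<close>. So its integral is the
  area of the image, which is finite because the image is bounded; injectivity ensures that the
  image is counted once.
\<close>
lemma area_integral_finite:
  fixes f :: "complex \<Rightarrow> complex"
  assumes holf: "f holomorphic_on S" and S: "open S" and inj: "inj_on f S" and bdd: "bounded (f ` S)"
  shows "(\<integral>\<^sup>+x. \<integral>\<^sup>+y. ennreal (indicator S (Complex x y) * (norm (deriv f (Complex x y)))\<^sup>2) \<partial>lborel \<partial>lborel) < \<infinity>"
proof -
  define S' where "S' = cplx_of_vec -` S"
  define g where "g = (\<lambda>v. vec_of_cplx (f (cplx_of_vec v)))"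
  define J where "J z = indicator S z * (norm (deriv f z))\<^sup>2" for z
  have "open S'"
    unfolding S'_def using S by (intro open_vimage) (simp_all add: linear_continuous_on bounded_linear_cplx_of_vec)
  have der: "(g has_derivative (\<lambda>h. vec_of_cplx (deriv f (cplx_of_vec v) * cplx_of_vec h))) (at v within S')"
    if "v \<in> S'" for v
  proof -
    have "(f has_field_derivative deriv f (cplx_of_vec v)) (at (cplx_of_vec v))"
      by (rule holomorphic_derivI[OF holf S]) (use that in \<open>simp add: S'_def\<close>)
    then have *: "(f has_derivative (*) (deriv f (cplx_of_vec v))) (at (cplx_of_vec v))"
      by (rule has_field_derivative_imp_has_derivative)
    have "(cplx_of_vec has_derivative cplx_of_vec) (at v)"
      by (rule bounded_linear_imp_has_derivative[OF bounded_linear_cplx_of_vec])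
    from has_derivative_compose[OF this *]
    have "((\<lambda>x. f (cplx_of_vec x)) has_derivative (\<lambda>h. deriv f (cplx_of_vec v) * cplx_of_vec h)) (at v)" .
    from bounded_linear.has_derivative[OF bounded_linear_vec_of_cplx this]
    show ?thesis unfolding g_def by (rule has_derivative_at_withinI)
  qed
  have injg: "inj_on g S'"
    proof (rule inj_onI)
    fix v w assume "v \<in> S'" "w \<in> S'" "g v = g w"
    then have "f (cplx_of_vec v) = f (cplx_of_vec w)"
      unfolding g_def by (metis vec_of_cplx_inverse)
    then have "cplx_of_vec v = cplx_of_vec w"
      using inj_onD[OF inj] \<open>v \<in> S'\<close> \<open>w \<in> S'\<close> by (simp add: S'_def)
    then show "v = w" by (metis cplx_of_vec_inverse)
  qed
  have gS: "g ` S' = cplx_of_vec -` (f ` S)"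
    unfolding g_def S'_def vec_of_cplx_image[symmetric] by (simp add: image_image)
  have "open (g ` S')"
    unfolding gS using open_mapping_thm3[OF holf S inj]
    by (intro open_vimage) (simp_all add: linear_continuous_on bounded_linear_cplx_of_vec)
  moreover have "bounded (g ` S')"
    unfolding gS vec_of_cplx_image[symmetric]
    using bdd bounded_linear_vec_of_cplx bounded_linear_image by blast
  ultimately have "g ` S' \<in> lmeasurable" by (rule lmeasurable_open[rotated])
  then have "(\<lambda>v. (norm (deriv f (cplx_of_vec v)))\<^sup>2) absolutely_integrable_on S'"
    using measurable_differentiable_image_alt[OF _ der injg] \<open>open S'\<close>
    by (simp add: abs_det_complex_multiplication)
  then have int: "integrable lebesgue (\<lambda>v. J (cplx_of_vec v))"
    unfolding set_integrable_def J_def S'_def by (simp add: indicator_def of_bool_def vimage_def)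
  have contd: "continuous_on S (deriv f)"
    using holf S by (simp add: holomorphic_deriv holomorphic_on_imp_continuous_on)
  have measJ: "J \<in> borel_measurable borel"
  proof -
    have "(\<lambda>z. indicator S z *\<^sub>R (norm (deriv f z))\<^sup>2) \<in> borel_measurable borel"
      using S by (intro borel_measurable_continuous_on_indicator continuous_intros contd) auto
    then show ?thesis by (simp add: J_def[abs_def])
  qed
  have mC: "(\<lambda>p::real \<times> real. Complex (fst p) (snd p)) \<in> borel_measurable borel"
    by (intro borel_measurable_continuous_onI continuous_intros)
  have mv: "(\<lambda>v::real^2. (v$1, v$2)) \<in> borel_measurable borel"
    by (intro borel_measurable_continuous_onI continuous_intros)
  have mJC: "(\<lambda>p::real \<times> real. J (Complex (fst p) (snd p))) \<in> borel_measurable borel"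
    using measurable_compose[OF mC measJ] by simp
  have "(\<integral>\<^sup>+x. \<integral>\<^sup>+y. ennreal (J (Complex x y)) \<partial>lborel \<partial>lborel)
      = (\<integral>\<^sup>+p. ennreal (J (Complex (fst p) (snd p))) \<partial>(lborel \<Otimes>\<^sub>M lborel))"
    using mJC by (subst lborel.nn_integral_fst[symmetric]) (auto simp: lborel_prod)
  also have "\<dots> = (\<integral>\<^sup>+p. ennreal (J (Complex (fst p) (snd p))) \<partial>distr lborel borel (\<lambda>v::real^2. (v$1, v$2)))"
    by (simp add: lborel_prod distr_lborel_vec2)
  also have "\<dots> = (\<integral>\<^sup>+v. ennreal (J (cplx_of_vec v)) \<partial>lborel)"
    using mJC mv by (subst nn_integral_distr) (auto simp: cplx_of_vec_def)
  also have "\<dots> = (\<integral>\<^sup>+v. ennreal (J (cplx_of_vec v)) \<partial>lebesgue)"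
  proof -
    have "(\<lambda>v. J (cplx_of_vec v)) \<in> borel_measurable borel"
      using measurable_compose[OF mv mJC] by (simp add: cplx_of_vec_def)
    then show ?thesis by (subst nn_integral_completion) auto
  qed
  also have "\<dots> < \<infinity>"
  proof -
    have "J z \<ge> 0" for z by (simp add: J_def)
    then show ?thesis using int by (simp add: integrable_iff_bounded)
  qed
  finally show ?thesis by (simp add: J_def)
qed

text \<open>
  The length-area principle in a half-strip. The integral of \<open>\<bar>deriv g\<bar>\<^sup>2\<close> over the half-strip is
  finite, hence its integrals over vertical segments cannot all stay above some \<open>\<delta> > 0\<close>. By the
  Cauchy-Schwarz inequality a small integral forces the image of the segment to be short.
\<close>
lemma short_vertical_crosscuts:
  fixes g :: "complex \<Rightarrow> complex" and b c :: real
  defines "S \<equiv> {s. c < Re s \<and> \<bar>Im s\<bar> < b}"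
  assumes holg: "g holomorphic_on S" and inj: "inj_on g S" and bdd: "bounded (g ` S)" and "0 < \<epsilon>"
  obtains t where "t > c" "t > t0"
    "\<And>y1 y2. \<bar>y1\<bar> < b \<Longrightarrow> \<bar>y2\<bar> < b \<Longrightarrow> norm (g (Complex t y1) - g (Complex t y2)) \<le> \<epsilon>"
proof -
  have "S = {s. c < Re s} \<inter> {s. Im s < b} \<inter> {s. -b < Im s}" by (auto simp: S_def)
  then have S: "open S"
    by (simp add: open_Int open_halfspace_Re_gt open_halfspace_Im_lt open_halfspace_Im_gt)
  define J where "J z = indicator S z * norm (deriv g z)" for z
  define u where "u x = (\<integral>\<^sup>+y. (ennreal (J (Complex x y)))\<^sup>2 \<partial>lborel)" for x
  have contd: "continuous_on S (deriv g)"
    using holg S by (simp add: holomorphic_deriv holomorphic_on_imp_continuous_on)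
  have measJ [measurable]: "J \<in> borel_measurable borel"
  proof -
    have "(\<lambda>z. indicator S z *\<^sub>R norm (deriv g z)) \<in> borel_measurable borel"
      using S by (intro borel_measurable_continuous_on_indicator continuous_intros contd) auto
    then show ?thesis by (simp add: J_def[abs_def])
  qed
  have mJC [measurable]: "(\<lambda>y. J (Complex x y)) \<in> borel_measurable borel" for x
  proof -
    have "(\<lambda>y. Complex x y) \<in> borel_measurable borel"
      by (intro borel_measurable_continuous_onI continuous_intros)
    from measurable_compose[OF this measJ] show ?thesis by simp
  qed
  have "(\<integral>\<^sup>+x. u x \<partial>lborel) < \<infinity>"
  proof -
    have "ennreal (indicator S z * (norm (deriv g z))\<^sup>2) = (ennreal (J z))\<^sup>2" for z
      by (auto simp: J_def indicator_def ennreal_power)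
    then show ?thesis using area_integral_finite[OF holg S inj bdd] by (simp add: u_def)
  qed
  \<comment> \<open>The segment has length \<open>2 * b\<close>, and Cauchy-Schwarz needs \<open>\<delta> * (2 * b) \<le> \<epsilon>\<^sup>2\<close>; the maximum
    keeps the quotient meaningful when the strip is empty.\<close>
  define \<delta> where "\<delta> = \<epsilon>\<^sup>2 / (2 * max b 1)"
  have "0 < \<delta>" using \<open>0 < \<epsilon>\<close> by (simp add: \<delta>_def)
  obtain t where t: "t > max c t0" "u t \<le> ennreal \<delta>"
  proof (rule ccontr)
    assume "\<not> thesis"
    with that have "ennreal \<delta> \<le> u t" if "t > max c t0" for t using that linear by blast
    then have "(\<integral>\<^sup>+x. ennreal \<delta> * indicator {max c t0<..} x \<partial>lborel) \<le> (\<integral>\<^sup>+x. u x \<partial>lborel)"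
      by (intro nn_integral_mono) (auto simp: indicator_def)
    also have "(\<integral>\<^sup>+x. ennreal \<delta> * indicator {max c t0<..} x \<partial>lborel) = ennreal \<delta> * emeasure lborel {max c t0<..}"
      by (rule nn_integral_cmult_indicator) simp
    also have "emeasure lborel {max c t0<..} = \<infinity>"
    proof (rule ccontr)
      assume "emeasure lborel {max c t0<..} \<noteq> \<infinity>"
      then obtain n where n: "emeasure lborel {max c t0<..} < of_nat n"
        using ennreal_Ex_less_of_nat by (auto simp: less_top)
      have "emeasure lborel {max c t0<..<max c t0 + real n} \<le> emeasure lborel {max c t0<..}"
        by (intro emeasure_mono) auto
      then show False using n by (simp add: ennreal_of_nat_eq_real_of_nat)
    qed
    finally show False using \<open>(\<integral>\<^sup>+x. u x \<partial>lborel) < \<infinity>\<close> \<open>0 < \<delta>\<close>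
      by (simp add: ennreal_mult_eq_top_iff top_unique)
  qed
  have le: "norm (g (Complex t y1) - g (Complex t y2)) \<le> \<epsilon>"
    if y: "\<bar>y1\<bar> < b" "\<bar>y2\<bar> < b" "y2 \<le> y1" for y1 y2
  proof -
    define d where "d y = \<i> * deriv g (Complex t y)" for y
    have inS: "Complex t y \<in> S" if "y \<in> {y2..y1}" for y
      using that y t(1) by (auto simp: S_def)
    have "((\<lambda>y. g (Complex t y)) has_vector_derivative d y) (at y within {y2..y1})" if "y \<in> {y2..y1}" for y
    proof -
      have 1: "((\<lambda>y. Complex t y) has_vector_derivative \<i>) (at y within {y2..y1})"
        unfolding Complex_eq by (auto intro!: derivative_eq_intros)
      have 2: "(g has_field_derivative deriv g (Complex t y)) (at (Complex t y) within Complex t ` {y2..y1})"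
        using holomorphic_derivI[OF holg S inS[OF that]] by (rule has_field_derivative_at_within)
      show ?thesis
        using field_vector_diff_chain_within[OF 1 2] by (simp add: d_def o_def)
    qed
    then have ftc: "(d has_integral (g (Complex t y1) - g (Complex t y2))) {y2..y1}"
      by (intro fundamental_theorem_of_calculus y(3)) auto
    have contn: "continuous_on {y2..y1} (\<lambda>y. norm (d y))"
      unfolding d_def using inS
      by (intro continuous_intros continuous_on_compose2[OF contd]) auto
    have "norm (g (Complex t y1) - g (Complex t y2)) \<le> integral {y2..y1} (\<lambda>y. norm (d y))"
      using ftc integral_norm_bound_integral[of d "{y2..y1}" "\<lambda>y. norm (d y)"] contn
      by (auto simp: integral_unique has_integral_integrable intro: integrable_continuous_real)
    moreover have "(\<integral>\<^sup>+y. ennreal (norm (d y)) * indicator {y2..y1} y \<partial>lborel)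
        = ennreal (integral {y2..y1} (\<lambda>y. norm (d y)))"
      using contn
      by (intro nn_integral_has_integral_lebesgue' integrable_integral integrable_continuous_real) auto
    moreover have "(\<integral>\<^sup>+y. ennreal (norm (d y)) * indicator {y2..y1} y \<partial>lborel)
        \<le> (\<integral>\<^sup>+y. ennreal (J (Complex t y)) * indicator {-b..b} y \<partial>lborel)"
      using inS y by (intro nn_integral_mono) (auto simp: indicator_def J_def d_def norm_mult)
    ultimately have "ennreal (norm (g (Complex t y1) - g (Complex t y2)))
         \<le> (\<integral>\<^sup>+y. ennreal (J (Complex t y)) * indicator {-b..b} y \<partial>lborel)"
      by (metis (no_types, lifting) ennreal_leI order_trans)
    then have "(ennreal (norm (g (Complex t y1) - g (Complex t y2))))\<^sup>2
        \<le> (\<integral>\<^sup>+y. ennreal (J (Complex t y)) * indicator {-b..b} y \<partial>lborel)\<^sup>2"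
      by (rule power_mono) simp
    also have "\<dots> \<le> u t * (\<integral>\<^sup>+y. (indicator {-b..b} y)\<^sup>2 \<partial>lborel)"
      unfolding u_def by (rule Cauchy_Schwarz_nn_integral) auto
    also have "(\<integral>\<^sup>+y. (indicator {-b..b} y)\<^sup>2 \<partial>lborel) = (\<integral>\<^sup>+y. indicator {-b..b} y \<partial>lborel)"
      by (intro nn_integral_cong) (auto simp: indicator_def)
    also have "\<dots> = ennreal (2 * b)" using y by simp
    also have "u t * ennreal (2 * b) \<le> ennreal \<delta> * ennreal (2 * b)"
      using t(2) by (intro mult_right_mono) auto
    also have "\<dots> = ennreal (\<delta> * (2 * b))" using \<open>0 < \<delta>\<close> y by (simp add: ennreal_mult)
    also have "\<dots> \<le> ennreal (\<epsilon>\<^sup>2)"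
    proof (rule ennreal_leI)
      have "\<delta> * (2 * b) = \<epsilon>\<^sup>2 * (b / max b 1)" by (simp add: \<delta>_def)
      also have "\<dots> \<le> \<epsilon>\<^sup>2" by (intro mult_left_le) (auto simp: divide_simps)
      finally show "\<delta> * (2 * b) \<le> \<epsilon>\<^sup>2" .
    qed
    finally have "(norm (g (Complex t y1) - g (Complex t y2)))\<^sup>2 \<le> \<epsilon>\<^sup>2"
      by (simp add: ennreal_power)
    then show ?thesis using \<open>0 < \<epsilon>\<close> by (simp add: abs_le_square_iff[symmetric])
  qed
  show thesis
  proof
    show "t > c" "t > t0" using t by auto
    fix y1 y2 assume "\<bar>y1\<bar> < b" "\<bar>y2\<bar> < b"
    then show "norm (g (Complex t y1) - g (Complex t y2)) \<le> \<epsilon>"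
      using le[of y1 y2] le[of y2 y1] by (cases "y2 \<le> y1") (auto simp: norm_minus_commute)
  qed
qed

section \<open>Strip coordinates at a point of the unit circle\<close>
abbreviation disc_exterior :: "complex set" where
  "disc_exterior \<equiv> {z. 1 < norm z}"

text \<open>
  The level sets are the circles of Apollonius for \<open>-c\<close> and \<open>c\<close>. Those of level above 1 meet the
  exterior of the unit disc in circular arcs that surround \<open>c\<close> and shrink to it as the level
  grows: these arcs serve as crosscuts.
\<close>
definition level :: "complex \<Rightarrow> complex \<Rightarrow> real" where
  "level c z = norm (z + c) / norm (z - c)"

text \<open>
  The exponential function maps the strip \<open>\<bar>Im s\<bar> < pi/2\<close> onto the right half-plane, and the
  Moebius map \<open>\<zeta> \<mapsto> c * (\<zeta> + 1) / (\<zeta> - 1)\<close> maps this half-plane onto the exterior of the unit disc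
  with \<open>\<infinity>\<close> going to \<open>c\<close>. The crosscut of level \<open>exp t\<close> is the image of the segment \<open>Re s = t\<close>.
  The point \<open>s = 0\<close> corresponds to infinity, so only \<open>Re s > 0\<close> is used.
\<close>
definition strip_map :: "complex \<Rightarrow> complex \<Rightarrow> complex" where
  "strip_map c s = c * (exp s + 1) / (exp s - 1)"

definition half_strip :: "real \<Rightarrow> complex set" where
  "half_strip a = {s. a < Re s \<and> \<bar>Im s\<bar> < pi/2}"

lemma open_disc_exterior: "open disc_exterior"
  by (intro open_Collect_less continuous_intros)

lemma exp_not_one: "0 < Re s \<Longrightarrow> exp s \<noteq> (1::complex)"
  by (metis exp_eq_one_iff exp_eq_1 less_irrefl)

lemma strip_map_diff:
  assumes "0 < Re s"
  shows "strip_map c s - c = 2 * c / (exp s - 1)" "strip_map c s + c = 2 * c * exp s / (exp s - 1)"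
  using exp_not_one[OF assms] by (simp_all add: strip_map_def field_simps)

lemma level_strip_map:
  assumes "norm c = 1" "0 < Re s"
  shows "level c (strip_map c s) = exp (Re s)"
  using assms exp_not_one[OF assms(2)]
  by (auto simp: level_def strip_map_diff norm_mult norm_divide)

lemma strip_map_in_exterior:
  assumes "norm c = 1" "s \<in> half_strip 0"
  shows "strip_map c s \<in> disc_exterior"
proof -
  have s: "0 < Re s" "\<bar>Im s\<bar> < pi/2" using assms(2) by (auto simp: half_strip_def)
  have "0 < Re (exp s)" using s(2) by (simp add: Re_exp cos_gt_zero_pi)
  then have "(norm (exp s - 1))\<^sup>2 < (norm (exp s + 1))\<^sup>2"
    unfolding cmod_power2 by (simp add: power2_eq_square algebra_simps)
  then have "norm (exp s - 1) < norm (exp s + 1)"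
    by (simp add: power2_less_imp_less)
  then show ?thesis
    using exp_not_one[OF s(1)] assms(1) by (simp add: strip_map_def norm_mult norm_divide)
qed

text \<open>The inverse map is the logarithm of \<open>(z + c) / (z - c)\<close>, whose modulus is the level of \<open>z\<close>.\<close>
lemma strip_map_surj:
  assumes c: "norm c = 1" and z: "z \<in> disc_exterior" and "1 < level c z"
  obtains s where "s \<in> half_strip 0" "Re s = ln (level c z)" "strip_map c s = z"
proof
  define w where "w = (z + c) / (z - c)"
  have nz: "z \<noteq> c" using c z by auto
  have nw: "norm w = level c z" by (simp add: w_def level_def norm_divide)
  have "Re w = Re ((z + c) * cnj (z - c)) / (norm (z - c))\<^sup>2"
    unfolding w_def by (subst complex_div_cnj) (simp add: Re_divide_of_real[symmetric])
  also have "Re ((z + c) * cnj (z - c)) = (norm z)\<^sup>2 - (norm c)\<^sup>2"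
    unfolding cmod_power2 by (simp add: power2_eq_square algebra_simps)
  finally have "0 < Re w" using c z nz by (simp add: one_less_power)
  then have w0: "w \<noteq> 0" by auto
  then have Im: "\<bar>Im (Ln w)\<bar> < pi/2" using Re_Ln_pos_lt[OF w0] \<open>0 < Re w\<close> by blast
  show re: "Re (Ln w) = ln (level c z)" using w0 nw by simp
  show "Ln w \<in> half_strip 0" using Im re assms(3) by (simp add: half_strip_def)
  have "w - 1 = 2 * c / (z - c)" "w + 1 = 2 * z / (z - c)" using nz by (auto simp: w_def field_simps)
  then show "strip_map c (Ln w) = z" using w0 nz c by (auto simp: strip_map_def)
qed

lemma inj_on_strip_map:
  assumes c: "norm c = 1"
  shows "inj_on (strip_map c) (half_strip 0)"
proof (rule inj_onI)
  have *: "Ln ((strip_map c s + c) / (strip_map c s - c)) = s" if "s \<in> half_strip 0" for s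
  proof -
    have s: "0 < Re s" "\<bar>Im s\<bar> < pi/2" using that by (auto simp: half_strip_def)
    have "(strip_map c s + c) / (strip_map c s - c) = exp s"
      using exp_not_one[OF s(1)] c by (auto simp: strip_map_diff[OF s(1)])
    then show ?thesis using s by simp
  qed
  fix s t assume "s \<in> half_strip 0" "t \<in> half_strip 0" "strip_map c s = strip_map c t"
  then show "s = t" using * by metis
qed

lemma holomorphic_on_strip_map: "strip_map c holomorphic_on half_strip 0"
  unfolding strip_map_def[abs_def]
  by (intro holomorphic_intros) (auto simp: half_strip_def dest: exp_not_one)

lemma image_half_strip:
  assumes c: "norm c = 1" and "0 \<le> a"
  shows "strip_map c ` half_strip a = {z \<in> disc_exterior. exp a < level c z}"
proof (intro set_eqI iffI)
  fix z assume "z \<in> strip_map c ` half_strip a"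
  then obtain s where s: "s \<in> half_strip a" "z = strip_map c s" by blast
  then have "s \<in> half_strip 0" "a < Re s" using \<open>0 \<le> a\<close> by (auto simp: half_strip_def)
  then show "z \<in> {z \<in> disc_exterior. exp a < level c z}"
    using strip_map_in_exterior[OF c] level_strip_map[OF c, of s] s \<open>0 \<le> a\<close> by auto
next
  fix z assume z: "z \<in> {z \<in> disc_exterior. exp a < level c z}"
  then have "exp a < level c z" by simp
  moreover have "1 \<le> exp a" using \<open>0 \<le> a\<close> by simp
  ultimately have l: "1 < level c z" by linarith
  obtain s where s: "s \<in> half_strip 0" "Re s = ln (level c z)" "strip_map c s = z"
    using strip_map_surj[OF c _ l] z by auto
  have "a < ln (level c z)" using z l by (subst exp_less_cancel_iff[symmetric]) simp
  with s show "z \<in> strip_map c ` half_strip a" by (auto simp: half_strip_def)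
qed

text \<open>In strip coordinates this set is a convex half-strip.\<close>
lemma connected_superlevel:
  assumes c: "norm c = 1" and "1 \<le> r"
  shows "connected {z \<in> disc_exterior. r < level c z}"
proof -
  have a: "0 \<le> ln r" "exp (ln r) = r" using \<open>1 \<le> r\<close> by auto
  have eq: "half_strip (ln r) = {s. ln r < Re s} \<inter> {s. Im s < pi/2} \<inter> {s. - (pi/2) < Im s}"
    by (auto simp: half_strip_def)
  have "convex (half_strip (ln r))"
    unfolding eq by (intro convex_Int convex_halfspace_Re_gt convex_halfspace_Im_lt convex_halfspace_Im_gt)
  moreover have "continuous_on (half_strip (ln r)) (strip_map c)"
    by (rule continuous_on_subset[OF holomorphic_on_imp_continuous_on[OF holomorphic_on_strip_map]])
       (unfold half_strip_def, use a(1) in force)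
  ultimately show ?thesis
    using image_half_strip[OF c a(1)] a(2) by (metis connected_continuous_image convex_connected)
qed

text \<open>
  Crosscuts at \<open>c\<close> with short images, of arbitrarily high level, are the short images of vertical
  segments read in strip coordinates.
\<close>
lemma short_crosscuts:
  assumes c: "norm c = 1" and holF: "F holomorphic_on disc_exterior" and inj: "inj_on F disc_exterior"
    and bdd: "bounded (F ` {z \<in> disc_exterior. r0 < level c z})" and "0 < \<epsilon>"
  obtains r where "r > R"
    "\<And>z z'. \<lbrakk>z \<in> disc_exterior; z' \<in> disc_exterior; level c z = r; level c z' = r\<rbrakk> \<Longrightarrow> norm (F z - F z') \<le> \<epsilon>"
proof -
  define a where "a = ln (max 1 r0)"
  have a: "0 \<le> a" "exp a = max 1 r0" by (auto simp: a_def)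
  have sub: "half_strip a \<subseteq> half_strip 0" using a(1) by (auto simp: half_strip_def)
  have im: "strip_map c ` half_strip a \<subseteq> {z \<in> disc_exterior. r0 < level c z}"
    using image_half_strip[OF c a(1)] a(2) by auto
  have hol: "(F \<circ> strip_map c) holomorphic_on half_strip a"
    using holomorphic_on_subset[OF holomorphic_on_strip_map sub] holF im
    by (intro holomorphic_on_compose_gen[where t = disc_exterior]) auto
  have inj': "inj_on (F \<circ> strip_map c) (half_strip a)"
    using inj_on_strip_map[OF c] sub im inj
    by (intro comp_inj_on) (auto intro: inj_on_subset)
  have bdd': "bounded ((F \<circ> strip_map c) ` half_strip a)"
    unfolding image_comp[symmetric] using im by (intro bounded_subset[OF bdd]) blast
  obtain t where t: "t > a" "t > ln (max 1 R)"
    "\<And>y1 y2. \<bar>y1\<bar> < pi/2 \<Longrightarrow> \<bar>y2\<bar> < pi/2 \<Longrightarrow>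
        norm ((F \<circ> strip_map c) (Complex t y1) - (F \<circ> strip_map c) (Complex t y2)) \<le> \<epsilon>"
    using short_vertical_crosscuts[of "F \<circ> strip_map c" a "pi/2" \<epsilon> "ln (max 1 R)"]
      hol inj' bdd' \<open>0 < \<epsilon>\<close> unfolding half_strip_def by blast
  have "0 < t" using t(1) a(1) by linarith
  have ex: "\<exists>y. \<bar>y\<bar> < pi/2 \<and> z = strip_map c (Complex t y)"
    if z: "z \<in> disc_exterior" "level c z = exp t" for z
  proof -
    have "1 < level c z" using z(2) \<open>0 < t\<close> by simp
    then obtain s where s: "s \<in> half_strip 0" "Re s = ln (level c z)" "strip_map c s = z"
      using strip_map_surj[OF c z(1)] by blast
    have "Complex t (Im s) = s" using s(2) z(2) by (simp add: complex_eq_iff)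
    then show ?thesis using s by (intro exI[of _ "Im s"]) (simp add: half_strip_def)
  qed
  show thesis
  proof
    have "R \<le> exp (ln (max 1 R))" by simp
    then show "R < exp t" using t(2) by (smt (verit) exp_less_mono)
    fix z z' assume z: "z \<in> disc_exterior" "z' \<in> disc_exterior" "level c z = exp t" "level c z' = exp t"
    obtain y y' where "\<bar>y\<bar> < pi/2" "z = strip_map c (Complex t y)" "\<bar>y'\<bar> < pi/2" "z' = strip_map c (Complex t y')"
      using ex[OF z(1,3)] ex[OF z(2,4)] by blast
    then show "norm (F z - F z') \<le> \<epsilon>" using t(3)[of y y'] by simp
  qed
qed

lemma level_set_nonempty:
  assumes "norm c = 1" "1 < r"
  obtains z where "z \<in> disc_exterior" "level c z = r"
proof
  have "of_real (ln r) \<in> half_strip 0" using assms(2) by (simp add: half_strip_def)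
  then show "strip_map c (of_real (ln r)) \<in> disc_exterior"
    using strip_map_in_exterior[OF assms(1)] by blast
  show "level c (strip_map c (of_real (ln r))) = r"
    using level_strip_map[OF assms(1), of "of_real (ln r)"] assms(2) by simp
qed

text \<open>Quantitatively, points of high level are close to \<open>c\<close>.\<close>
lemma dist_le_of_level:
  assumes c: "norm c = 1" and z: "z \<in> disc_exterior" and r: "1 < r" "r < level c z"
  shows "norm (z - c) \<le> 2 / (r - 1)"
proof -
  have "z \<noteq> c" using c z by auto
  then have "r * norm (z - c) < norm (z + c)" using r(2) by (simp add: level_def pos_less_divide_eq)
  also have "norm (z + c) \<le> norm (z - c) + 2"
    using norm_triangle_ineq[of "z - c" "2 * c"] c by (simp add: norm_mult add.commute)
  finally have "(r - 1) * norm (z - c) \<le> 2" by (simp add: algebra_simps)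
  then show ?thesis using r(1) by (simp add: pos_le_divide_eq mult.commute)
qed

lemma level_at_top_iff:
  assumes c: "norm c = 1" and z: "\<And>n. z n \<in> disc_exterior"
  shows "filterlim (\<lambda>n. level c (z n)) at_top sequentially \<longleftrightarrow> z \<longlonglongrightarrow> c"
proof
  assume lim: "z \<longlonglongrightarrow> c"
  have zc: "z n \<noteq> c" for n using c z[of n] by auto
  have "(\<lambda>n. norm (z n - c)) \<longlonglongrightarrow> 0"
    using lim by (simp add: tendsto_norm_zero_iff LIM_zero_iff)
  moreover have "(\<lambda>n. norm (z n + c)) \<longlonglongrightarrow> norm (c + c)"
    by (intro tendsto_intros lim)
  moreover have "0 < norm (c + c)" using c by auto
  ultimately show "filterlim (\<lambda>n. level c (z n)) at_top sequentially"
    unfolding level_def using zc by (intro LIM_at_top_divide) auto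
next
  assume lim: "filterlim (\<lambda>n. level c (z n)) at_top sequentially"
  show "z \<longlonglongrightarrow> c"
  proof (rule metric_LIMSEQ_I)
    fix e :: real assume "0 < e"
    have "\<forall>\<^sub>F n in sequentially. 1 + 2 / (e/2) < level c (z n)"
      using lim by (simp add: filterlim_at_top_dense)
    then have "\<forall>\<^sub>F n in sequentially. dist (z n) c < e"
    proof eventually_elim
      case (elim n)
      have "norm (z n - c) \<le> 2 / ((1 + 2 / (e/2)) - 1)"
        by (rule dist_le_of_level[OF c z _ elim]) (use \<open>0 < e\<close> in simp)
      then show ?case using \<open>0 < e\<close> by (simp add: dist_norm)
    qed
    then show "\<exists>no. \<forall>n\<ge>no. dist (z n) c < e" by (simp add: eventually_sequentially)
  qed
qed

lemma continuous_on_level: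
  assumes "norm c = 1" shows "continuous_on disc_exterior (level c)"
  unfolding level_def[abs_def] using assms by (intro continuous_intros) auto

section \<open>Principal points are not separated from the impression\<close>

text \<open>
  A connected set in the complement of \<open>X \<union> K\<close> that contains both image points would lie in the
  unbounded domain. Its preimage under \<open>F\<close> is connected, so \<open>l\<close> takes the value \<open>r\<close> on it; but
  the points where this happens are mapped into \<open>K\<close>.
\<close>
lemma crosscut_separates:
  fixes F G :: "complex \<Rightarrow> complex" and l :: "complex \<Rightarrow> real"
  assumes im: "F ` D = outside X" and G: "continuous_on (outside X) G" "\<And>z. z \<in> D \<Longrightarrow> G (F z) = z"
    and l: "continuous_on D l" and cut: "F ` {z \<in> D. l z = r} \<subseteq> K"
    and z: "z \<in> D" "z' \<in> D" "l z < r" "r < l z'"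
  shows "\<not> connected_component (- (X \<union> K)) (F z) (F z')"
proof
  assume "connected_component (- (X \<union> K)) (F z) (F z')"
  then obtain T where T: "connected T" "T \<subseteq> - (X \<union> K)" "F z \<in> T" "F z' \<in> T"
    by (auto simp: connected_component_def)
  have "T \<subseteq> outside X"
  proof
    fix x assume "x \<in> T"
    then have "connected_component (- X) (F z) x" using T by (auto simp: connected_component_def)
    then show "x \<in> outside X" using im z(1) by (blast intro: outside_same_component)
  qed
  have GT: "G x \<in> D \<and> F (G x) = x" if "x \<in> T" for x
    using that \<open>T \<subseteq> outside X\<close> im G(2) by force
  have "continuous_on T (\<lambda>x. l (G x))"
    using GT \<open>T \<subseteq> outside X\<close> by (intro continuous_on_compose2[OF l continuous_on_subset[OF G(1)]]) auto
  then have "connected ((\<lambda>x. l (G x)) ` T)" using T(1) by (rule connected_continuous_image)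
  moreover have "l z \<in> (\<lambda>x. l (G x)) ` T" "l z' \<in> (\<lambda>x. l (G x)) ` T"
    using image_eqI[OF _ T(3), of "l z" "\<lambda>x. l (G x)"] image_eqI[OF _ T(4), of "l z'" "\<lambda>x. l (G x)"] z(1,2) G(2)
    by simp_all
  ultimately have "r \<in> (\<lambda>x. l (G x)) ` T"
    using connected_contains_Icc[of _ "l z" "l z'"] z(3,4) by fastforce
  then obtain x where "x \<in> T" "l (G x) = r" by auto
  then have "x \<in> K" using GT[of x] cut by (metis (mono_tags, lifting) image_subset_iff mem_Collect_eq)
  then show False using T \<open>x \<in> T\<close> by auto
qed

text \<open>
  The assumption \<open>cuts\<close> makes \<open>w\<close> a principal point: crosscuts of arbitrarily high level have
  images close to \<open>w\<close>. Points of increasing level with images near \<open>y\<close> are interlaced with such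
  crosscuts, which separates infinitely many points of \<open>outside X\<close> from one another by \<open>P \<union> Q\<close>, though
  not by \<open>P\<close> or \<open>Q\<close> alone.
\<close>
lemma not_separated_from_principal_point:
  fixes F G :: "complex \<Rightarrow> complex" and l :: "complex \<Rightarrow> real"
  assumes X: "compact X" "frontier X = X"
    and im: "F ` D = outside X" and G: "continuous_on (outside X) G" "\<And>z. z \<in> D \<Longrightarrow> G (F z) = z"
    and l: "continuous_on D l"
    and cuts: "\<And>\<epsilon> t. 0 < \<epsilon> \<Longrightarrow> \<exists>r>t. F ` {z \<in> D. l z = r} \<subseteq> cball w \<epsilon>"
    and u: "\<And>n. u n \<in> D" "filterlim (\<lambda>n. l (u n)) at_top sequentially" "(\<lambda>n. F (u n)) \<longlonglongrightarrow> y"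
    and C: "finite C" "C \<subseteq> X"
  shows "\<not> separated_by X C w y"
proof
  assume "separated_by X C w y"
  then obtain A B where AB: "X - C = A \<union> B" "closure A \<inter> B = {}" "A \<inter> closure B = {}" "w \<in> A" "y \<in> B"
    unfolding separated_by_def X(2) by blast
  have "closed X" using X(1) by (rule compact_imp_closed)
  have clA: "closure A \<subseteq> A \<union> C" and clB: "closure B \<subseteq> B \<union> C"
    using closure_minimal[OF _ \<open>closed X\<close>, of A] closure_minimal[OF _ \<open>closed X\<close>, of B] AB by blast+
  have "A \<union> C = closure A \<union> C" "B \<union> C = closure B \<union> C" using clA clB closure_subset by blast+
  then have closed: "closed (A \<union> C)" "closed (B \<union> C)"
    using C(1) by (metis closed_Un closed_closure finite_imp_closed)+
  have notin: "w \<notin> B \<union> C" "y \<notin> A \<union> C" using AB closure_subset by blast+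
  obtain \<epsilon> where \<epsilon>: "0 < \<epsilon>" "cball w \<epsilon> \<inter> (B \<union> C) = {}" "y \<notin> cball w \<epsilon>"
  proof -
    have "open (- (B \<union> C))" using closed(2) by (rule open_Compl)
    then obtain e where "0 < e" "cball w e \<subseteq> - (B \<union> C)"
      using notin(1) by (meson ComplI open_contains_cball)
    then show thesis using that[of e] AB(5) by blast
  qed
  define P where "P = A \<union> C \<union> cball w \<epsilon>"
  define Q where "Q = B \<union> C"
  have sub: "A \<union> C \<subseteq> X" "B \<union> C \<subseteq> X" using AB(1) C(2) by auto
  have cP: "compact P" and cQ: "compact Q"
    using compact_Int_closed[OF X(1) closed(1)] compact_Int_closed[OF X(1) closed(2)] sub
    unfolding P_def Q_def by (auto simp: Int_absorb1 intro!: compact_Un)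
  have PQ: "P \<inter> Q = C" "P \<union> Q = X \<union> cball w \<epsilon>"
    using \<epsilon>(2) AB C(2) closure_subset unfolding P_def Q_def by blast+
  have "closed P" "y \<notin> P" using cP notin \<epsilon>(3) by (auto simp: P_def compact_imp_closed)
  then obtain \<delta> where \<delta>: "0 < \<delta>" "ball y \<delta> \<subseteq> - P"
    by (meson ComplI closed_open open_contains_ball)
  have far: "\<exists>z\<in>D. F z \<in> ball y \<delta> \<and> t < l z" for t
  proof -
    have "\<forall>\<^sub>F n in sequentially. dist (F (u n)) y < \<delta>" using u(3) \<delta>(1) by (rule tendstoD)
    moreover have "\<forall>\<^sub>F n in sequentially. t < l (u n)" using u(2) by (simp add: filterlim_at_top_dense)
    ultimately have "\<forall>\<^sub>F n in sequentially. dist (F (u n)) y < \<delta> \<and> t < l (u n)" by (rule eventually_conj)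
    then obtain n where "dist (F (u n)) y < \<delta>" "t < l (u n)"
      using eventually_happens by force
    then show ?thesis using u(1)[of n] by (intro bexI[of _ "u n"]) (auto simp: dist_commute)
  qed
  have "\<exists>z. \<forall>n. (z n \<in> D \<and> F (z n) \<in> ball y \<delta>) \<and>
       (\<exists>r. l (z n) < r \<and> r < l (z (Suc n)) \<and> F ` {x \<in> D. l x = r} \<subseteq> cball w \<epsilon>)"
  proof (rule dependent_nat_choice)
    show "\<exists>z. z \<in> D \<and> F z \<in> ball y \<delta>" using far by blast
    fix z n assume "z \<in> D \<and> F z \<in> ball y \<delta>"
    obtain r where "l z < r" "F ` {x \<in> D. l x = r} \<subseteq> cball w \<epsilon>" using cuts[OF \<epsilon>(1)] by blast
    then show "\<exists>z'. (z' \<in> D \<and> F z' \<in> ball y \<delta>) \<and>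
       (\<exists>r. l z < r \<and> r < l z' \<and> F ` {x \<in> D. l x = r} \<subseteq> cball w \<epsilon>)" using far by blast
  qed
  then obtain z where z: "\<And>n. z n \<in> D" "\<And>n. F (z n) \<in> ball y \<delta>"
    "\<And>n. \<exists>r. l (z n) < r \<and> r < l (z (Suc n)) \<and> F ` {x \<in> D. l x = r} \<subseteq> cball w \<epsilon>" by blast
  have mono: "l (z i) \<le> l (z j)" if "i \<le> j" for i j
  proof (rule lift_Suc_mono_le[of "\<lambda>n. l (z n)", OF _ that])
    show "l (z n) \<le> l (z (Suc n))" for n using z(3)[of n] by auto
  qed
  show False
  proof (rule finite_intersection_separates_finitely_many[OF cP cQ, of "\<lambda>n. F (z n)"])
    show "finite (P \<inter> Q)" using PQ C by simp
    show "connected_component (- P) (F (z i)) (F (z j))" for i j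
      using z(2) \<delta>(2) unfolding connected_component_def by (intro exI[of _ "ball y \<delta>"]) auto
    show "connected_component (- Q) (F (z i)) (F (z j))" for i j
      unfolding connected_component_def
    proof (intro exI conjI)
      show "connected (outside X)" using X(1) by (intro connected_outside) (auto simp: compact_imp_bounded)
      show "outside X \<subseteq> - Q" using outside_no_overlap[of X] sub(2) unfolding Q_def by blast
    qed (use im z(1) in auto)
    fix i j :: nat assume "i < j" and con: "connected_component (- (P \<union> Q)) (F (z i)) (F (z j))"
    obtain r where r: "l (z i) < r" "r < l (z (Suc i))" "F ` {x \<in> D. l x = r} \<subseteq> cball w \<epsilon>"
      using z(3) by blast
    have "l (z (Suc i)) \<le> l (z j)" using mono \<open>i < j\<close> by simp
    then have "\<not> connected_component (- (X \<union> cball w \<epsilon>)) (F (z i)) (F (z j))"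
      using r by (intro crosscut_separates[OF im G l r(3) z(1) z(1)]) auto
    then show False using con PQ(2) by simp
  qed
qed

section \<open>The Riemann map on finite points\<close>
lemma limitin_ext_Some:
  "limitin ext_topology (\<lambda>n. Some (u n)) (Some l) sequentially \<longleftrightarrow> u \<longlonglongrightarrow> l"
proof -
  have "limitin ext_topology (\<lambda>n. Some (u n)) (Some l) sequentially" if "u \<longlonglongrightarrow> l"
    unfolding limitin_def
  proof (intro conjI allI impI)
    fix V assume V: "openin ext_topology V \<and> Some l \<in> V"
    then have "openin euclidean {x \<in> topspace euclidean. Some x \<in> V}"
      using openin_continuous_map_preimage[OF continuous_map_Some] by blast
    then have "open {x. Some x \<in> V}" by simp
    then show "\<forall>\<^sub>F n in sequentially. Some (u n) \<in> V"
      using topological_tendstoD[OF that, of "{x. Some x \<in> V}"] V by simp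
  qed simp
  moreover have "u \<longlonglongrightarrow> l" if "limitin ext_topology (\<lambda>n. Some (u n)) (Some l) sequentially"
  proof (rule topological_tendstoI)
    fix S assume "open S" "l \<in> S"
    then have "openin ext_topology (Some ` S)" by simp
    then have "\<forall>\<^sub>F n in sequentially. Some (u n) \<in> Some ` S"
      using that \<open>l \<in> S\<close> unfolding limitin_def by blast
    then show "\<forall>\<^sub>F n in sequentially. u n \<in> S" by (rule eventually_mono) auto
  qed
  ultimately show ?thesis by blast
qed

lemma limitin_ext_eventually_finite:
  assumes "limitin ext_topology z (Some l) sequentially"
  shows "\<forall>\<^sub>F n in sequentially. z n \<noteq> None"
proof -
  have "openin ext_topology (Some ` UNIV)" by simp
  then have "\<forall>\<^sub>F n in sequentially. z n \<in> Some ` UNIV"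
    using assms unfolding limitin_def by blast
  then show ?thesis by (rule eventually_mono) auto
qed

text \<open>
  The sequences in the definition of the impression converge to finite points, so they avoid
  infinity from some index on, and dropping an initial segment turns them into sequences in the
  plane.
\<close>
lemma impression_eq_cluster_set:
  assumes fin: "\<And>z. z \<in> disc_exterior \<Longrightarrow> \<Phi> (Some z) = Some (F z)"
  shows "impression X \<Phi> \<theta> =
    {w \<in> X. \<exists>u. (\<forall>n. u n \<in> disc_exterior) \<and> u \<longlonglongrightarrow> cis \<theta> \<and> (\<lambda>n. F (u n)) \<longlonglongrightarrow> w}"
proof (intro set_eqI iffI)
  fix w assume "w \<in> impression X \<Phi> \<theta>"
  then obtain z where w: "w \<in> X" and z: "\<And>n. z n \<in> ext_disc_exterior"
    and lz: "limitin ext_topology z (Some (cis \<theta>)) sequentially"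
    and l\<Phi>: "limitin ext_topology (\<lambda>n. \<Phi> (z n)) (Some w) sequentially"
    unfolding impression_def by blast
  obtain N where N: "\<And>n. n \<ge> N \<Longrightarrow> z n \<noteq> None"
    using limitin_ext_eventually_finite[OF lz] unfolding eventually_sequentially by blast
  define u where "u n = the (z (n + N))" for n
  have u: "z (n + N) = Some (u n)" for n using N[of "n + N"] by (simp add: u_def)
  have D: "u n \<in> disc_exterior" for n
    using z[of "n + N"] unfolding u ext_disc_exterior_def by auto
  have "u \<longlonglongrightarrow> cis \<theta>"
    using lz by (subst limitin_ext_Some[symmetric], subst u[symmetric]) (rule limitin_sequentially_offset)
  moreover have "(\<lambda>n. F (u n)) \<longlonglongrightarrow> w"
  proof -
    have "limitin ext_topology (\<lambda>n. \<Phi> (z (n + N))) (Some w) sequentially"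
      using l\<Phi> by (rule limitin_sequentially_offset)
    then show ?thesis by (simp add: u fin[OF D] limitin_ext_Some)
  qed
  ultimately show "w \<in> {w \<in> X. \<exists>u. (\<forall>n. u n \<in> disc_exterior) \<and> u \<longlonglongrightarrow> cis \<theta> \<and> (\<lambda>n. F (u n)) \<longlonglongrightarrow> w}"
    using w D by blast
next
  fix w assume "w \<in> {w \<in> X. \<exists>u. (\<forall>n. u n \<in> disc_exterior) \<and> u \<longlonglongrightarrow> cis \<theta> \<and> (\<lambda>n. F (u n)) \<longlonglongrightarrow> w}"
  then obtain u where u: "w \<in> X" "\<And>n. u n \<in> disc_exterior" "u \<longlonglongrightarrow> cis \<theta>" "(\<lambda>n. F (u n)) \<longlonglongrightarrow> w" by blast
  have "limitin ext_topology (\<lambda>n. \<Phi> (Some (u n))) (Some w) sequentially"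
    using u(4) by (simp only: fin[OF u(2)] limitin_ext_Some)
  then show "w \<in> impression X \<Phi> \<theta>"
    unfolding impression_def using u
    by (auto simp: ext_disc_exterior_def limitin_ext_Some intro!: exI[of _ "\<lambda>n. Some (u n)"])
qed

definition finite_part :: "(ext_complex \<Rightarrow> ext_complex) \<Rightarrow> complex \<Rightarrow> complex" where
  "finite_part \<Phi> z = the (\<Phi> (Some z))"

text \<open>
  The last claim needs the behaviour at infinity. In the chart \<open>1/z\<close> the map is holomorphic and
  not constant near 0, hence open there, so that a whole neighbourhood of infinity is covered by
  the image of a small neighbourhood of infinity. By injectivity \<open>F\<close> can take no large value
  elsewhere.
\<close>
lemma exterior_riemann_map_finite_part:
  assumes "exterior_riemann_map X \<Phi>"
  defines "F \<equiv> finite_part \<Phi>"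
  shows "\<And>z. z \<in> disc_exterior \<Longrightarrow> \<Phi> (Some z) = Some (F z)"
    and "F holomorphic_on disc_exterior" and "inj_on F disc_exterior" and "F ` disc_exterior = outside X"
    and "\<exists>R>1. bounded (F ` {z. 1 < norm z \<and> norm z < R})"
proof -
  have bij: "bij_betw \<Phi> ext_disc_exterior (ext_outside X)" and inf: "\<Phi> None = None"
    and hol: "F holomorphic_on disc_exterior"
    using assms(1) unfolding exterior_riemann_map_def F_def finite_part_def[abs_def] by auto
  obtain c :: real where c: "0 < c"
      "((\<lambda>\<zeta>. inf_chart (\<Phi> (inf_param \<zeta>))) has_field_derivative complex_of_real c) (at 0)"
    using assms(1) unfolding exterior_riemann_map_def by blast
  have inj: "inj_on \<Phi> ext_disc_exterior" and im: "\<Phi> ` ext_disc_exterior = ext_outside X"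
    using bij by (auto simp: bij_betw_def)
  have S: "Some z \<in> ext_disc_exterior \<longleftrightarrow> z \<in> disc_exterior" "None \<in> ext_disc_exterior" for z
    by (auto simp: ext_disc_exterior_def)
  have fin: "\<Phi> (Some z) = Some (F z)" if "z \<in> disc_exterior" for z
    using inj_onD[OF inj, of "Some z" None] inf S that unfolding F_def finite_part_def
    by (cases "\<Phi> (Some z)") auto
  then show "\<And>z. z \<in> disc_exterior \<Longrightarrow> \<Phi> (Some z) = Some (F z)" .
  show "F holomorphic_on disc_exterior" by (rule hol)
  show injF: "inj_on F disc_exterior"
  proof (rule inj_onI)
    fix z w assume "z \<in> disc_exterior" "w \<in> disc_exterior" "F z = F w"
    then show "z = w" using inj_onD[OF inj, of "Some z" "Some w"] fin S by simp
  qed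
  show "F ` disc_exterior = outside X"
  proof (intro set_eqI iffI)
    fix w assume "w \<in> F ` disc_exterior"
    then obtain z where "z \<in> disc_exterior" "w = F z" by blast
    then have "Some w \<in> ext_outside X" using im fin S(1) by (metis imageI)
    then show "w \<in> outside X" by (auto simp: ext_outside_def)
  next
    fix w assume "w \<in> outside X"
    then have "Some w \<in> \<Phi> ` ext_disc_exterior" using im by (simp add: ext_outside_def)
    then obtain p where p: "p \<in> ext_disc_exterior" "Some w = \<Phi> p" by blast
    then obtain z where "p = Some z" using inf by (cases p) auto
    then show "w \<in> F ` disc_exterior" using p S(1) fin by auto
  qed
  define h where "h \<zeta> = inf_chart (\<Phi> (inf_param \<zeta>))" for \<zeta>
  have h0: "h 0 = 0" by (simp add: h_def inf_param_def inf inf_chart_def)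
  have inv: "inverse \<zeta> \<in> disc_exterior" if "\<zeta> \<noteq> 0" "norm \<zeta> < 1" for \<zeta> :: complex
    using that by (simp add: norm_inverse one_less_inverse)
  have h: "h \<zeta> = inverse (F (inverse \<zeta>))" if "\<zeta> \<noteq> 0" "norm \<zeta> < 1" for \<zeta>
    using that fin[OF inv[OF that]] by (simp add: h_def inf_param_def inf_chart_def)
  \<comment> \<open>A zero of \<open>F\<close> would be a pole of \<open>h\<close>. There is at most one by injectivity, and the disc of
    radius \<open>e\<close> avoids it.\<close>
  obtain e where e: "0 < e" "e < 1" "\<And>\<zeta>. \<zeta> \<noteq> 0 \<Longrightarrow> norm \<zeta> < e \<Longrightarrow> F (inverse \<zeta>) \<noteq> 0"
  proof (cases "\<exists>z\<in>disc_exterior. F z = 0")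
    case True
    then obtain z where z: "z \<in> disc_exterior" "F z = 0" by blast
    show thesis
    proof
      show "0 < inverse (norm z)" "inverse (norm z) < 1" using z(1) by (auto simp: inverse_less_1_iff)
      fix \<zeta> :: complex assume \<zeta>: "\<zeta> \<noteq> 0" "norm \<zeta> < inverse (norm z)"
      then have "norm \<zeta> < 1" using \<open>inverse (norm z) < 1\<close> by linarith
      moreover have "inverse \<zeta> \<noteq> z" using \<zeta> by (metis inverse_inverse_eq less_irrefl norm_inverse)
      ultimately show "F (inverse \<zeta>) \<noteq> 0" using inj_onD[OF injF, of "inverse \<zeta>" z] z inv \<zeta>(1) by auto
    qed
  next
    case False
    show thesis by (rule that[of "1/2"]) (use False inv in auto)
  qed
  have "h holomorphic_on ball 0 e"
  proof (rule no_isolated_singularity[of _ _ "{0}"])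
    have "(\<lambda>\<zeta>. inverse (F (inverse \<zeta>))) holomorphic_on ball 0 e - {0}"
    proof -
      have "(F \<circ> inverse) holomorphic_on ball 0 e - {0}"
        by (rule holomorphic_on_compose_gen[OF _ hol])
           (use e inv in \<open>auto intro!: holomorphic_intros\<close>)
      then show ?thesis using e(3) by (intro holomorphic_intros) (auto simp: o_def)
    qed
    then show hol': "h holomorphic_on ball 0 e - {0}"
      by (rule holomorphic_transform) (use h e(2) in auto)
    show "continuous_on (ball 0 e) h"
      unfolding continuous_on_eq_continuous_at[OF open_ball]
    proof
      fix \<zeta> :: complex assume \<zeta>: "\<zeta> \<in> ball 0 e"
      show "isCont h \<zeta>"
      proof (cases "\<zeta> = 0")
        case True
        then show ?thesis using DERIV_isCont[OF c(2)] by (simp add: h_def[abs_def])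
      next
        case False
        have "open (ball 0 e - {0::complex})" by auto
        then show ?thesis
          using holomorphic_on_imp_continuous_on[OF hol'] \<zeta> False
          by (simp add: continuous_on_eq_continuous_at)
      qed
    qed
  qed auto
  moreover have "\<not> h constant_on ball 0 e"
  proof
    assume "h constant_on ball 0 e"
    then have "h (of_real (e/2)) = h 0" using e(1) unfolding constant_on_def
      by (metis (no_types, lifting) centre_in_ball dist_0_norm mem_ball norm_of_real abs_of_pos half_gt_zero field_less_half_sum field_sum_of_halves less_add_same_cancel1)
    moreover have "F (inverse (of_real (e/2))) \<noteq> 0" by (rule e(3)) (use e(1) in simp_all)
    ultimately show False using e h[of "of_real (e/2)"] h0 by simp
  qed
  ultimately have op: "open (h ` ball 0 e)"
    by (intro open_mapping_thm[of h "ball 0 e"]) auto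
  have "0 \<in> h ` ball 0 e" using h0 e(1) by (metis centre_in_ball imageI)
  then obtain d where d: "0 < d" "ball 0 d \<subseteq> h ` ball 0 e" using op by (meson open_contains_ball)
  have "norm (F z) \<le> inverse d" if z: "1 < norm z" "norm z < inverse e" for z
  proof (rule ccontr)
    assume "\<not> norm (F z) \<le> inverse d"
    then have big: "inverse d < norm (F z)" by simp
    then have "F z \<noteq> 0" using d(1) by auto
    have "norm (inverse (F z)) < d"
      using big d(1) by (metis inverse_inverse_eq inverse_less_imp_less inverse_positive_iff_positive less_imp_inverse_less norm_inverse)
    then obtain \<zeta> where \<zeta>: "norm \<zeta> < e" "h \<zeta> = inverse (F z)" using d(2) by fastforce
    have "\<zeta> \<noteq> 0" using \<zeta>(2) h0 \<open>F z \<noteq> 0\<close> by auto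
    moreover have "norm \<zeta> < 1" using \<zeta>(1) e(2) by linarith
    ultimately have "F (inverse \<zeta>) = F z" "inverse \<zeta> \<in> disc_exterior"
      using h[of \<zeta>] \<zeta>(2) inv[of \<zeta>] by auto
    then have "inverse \<zeta> = z" using inj_onD[OF injF] z(1) by blast
    then have "norm z = inverse (norm \<zeta>)" by (metis norm_inverse)
    moreover have "inverse e < inverse (norm \<zeta>)" using \<zeta>(1) \<open>\<zeta> \<noteq> 0\<close> by (intro less_imp_inverse_less) auto
    ultimately show False using z(2) by linarith
  qed
  then have "bounded (F ` {z. 1 < norm z \<and> norm z < inverse e})" by (intro boundedI) auto
  moreover have "1 < inverse e" using e by (simp add: one_less_inverse)
  ultimately show "\<exists>R>1. bounded (F ` {z. 1 < norm z \<and> norm z < R})" by blast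
qed


section \<open>Impressions lie in fibers\<close>

text \<open>
  The setting of the theorem with the point at infinity removed: \<open>F\<close> is the Riemann map on
  finite points and \<open>c\<close> the point of the circle whose impression is studied.
\<close>

locale exterior_map_at_boundary_point =
  fixes X :: "complex set" and F :: "complex \<Rightarrow> complex" and c :: complex
  assumes compact_X: "compact X" and frontier_outside_X: "frontier (outside X) = X"
    and holomorphic_F: "F holomorphic_on disc_exterior"
    and inj_F: "inj_on F disc_exterior"
    and image_F: "F ` disc_exterior = outside X"
    and bounded_near_circle: "\<exists>R>1. bounded (F ` {z. 1 < norm z \<and> norm z < R})"
    and norm_c: "norm c = 1"
begin

definition cluster_set :: "complex set" where
  "cluster_set = {w. \<exists>u. (\<forall>n. u n \<in> disc_exterior) \<and> u \<longlonglongrightarrow> c \<and> (\<lambda>n. F (u n)) \<longlonglongrightarrow> w}"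

definition tail_image :: "real \<Rightarrow> complex set" where
  "tail_image t = F ` {z \<in> disc_exterior. t < level c z}"

lemma cluster_setE:
  assumes "w \<in> cluster_set"
  obtains u where "\<And>n. u n \<in> disc_exterior" "u \<longlonglongrightarrow> c" "(\<lambda>n. F (u n)) \<longlonglongrightarrow> w"
  using assms unfolding cluster_set_def mem_Collect_eq by (elim exE conjE) blast

lemma open_outside_X: "open (outside X)"
  using compact_X by (simp add: compact_imp_closed open_outside)

lemma interior_X: "interior X = {}"
proof -
  have "interior X \<inter> outside X = {}" using interior_subset[of X] outside_no_overlap[of X] by blast
  then have "interior X \<inter> closure (outside X) = {}" by (simp add: open_Int_closure_eq_empty)
  moreover have "X \<subseteq> closure (outside X)"
    using frontier_outside_X unfolding frontier_def by blast
  ultimately show ?thesis using interior_subset[of X] by blast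
qed

lemma frontier_X: "frontier X = X"
  using compact_X by (simp add: frontier_def interior_X compact_imp_closed)

lemma continuous_inverse:
  obtains G where "continuous_on (outside X) G" "\<And>z. z \<in> disc_exterior \<Longrightarrow> G (F z) = z"
proof -
  obtain G where "G holomorphic_on (F ` disc_exterior)" and GF: "\<And>z. z \<in> disc_exterior \<Longrightarrow> G (F z) = z"
    using holomorphic_has_inverse[OF holomorphic_F open_disc_exterior inj_F] by metis
  then show thesis using that image_F holomorphic_on_imp_continuous_on by metis
qed

text \<open>
  A limit inside the domain is excluded: applying the inverse map there would give \<open>c\<close> as an
  interior point of the exterior of the disc.
\<close>

lemma cluster_set_subset: "cluster_set \<subseteq> X"
proof
  fix w assume "w \<in> cluster_set"
  then obtain u where u: "\<And>n. u n \<in> disc_exterior" "u \<longlonglongrightarrow> c" "(\<lambda>n. F (u n)) \<longlonglongrightarrow> w"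
    by (rule cluster_setE) blast
  obtain G where contG: "continuous_on (outside X) G" and GF: "\<And>z. z \<in> disc_exterior \<Longrightarrow> G (F z) = z"
    by (rule continuous_inverse) blast
  have Fu: "F (u n) \<in> outside X" for n using u(1) image_F by blast
  have "w \<notin> outside X"
  proof
    assume w: "w \<in> outside X"
    then have "isCont G w" using contG open_outside_X by (simp add: continuous_on_eq_continuous_at)
    then have "(\<lambda>n. G (F (u n))) \<longlonglongrightarrow> G w" using u(3) by (rule isCont_tendsto_compose)
    then have "u \<longlonglongrightarrow> G w" by (simp only: GF[OF u(1)])
    then have "G w = c" using u(2) by (rule LIMSEQ_unique)
    moreover have "G w \<in> disc_exterior" using w image_F GF by (metis imageE)
    ultimately show False using norm_c by simp
  qed
  moreover have "w \<in> closure (outside X)" using Fu u(3) by (metis closure_sequential)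
  ultimately have "w \<in> frontier (outside X)"
    using open_outside_X by (simp add: frontier_def interior_open)
  then show "w \<in> X" by (simp only: frontier_outside_X)
qed

lemma bounded_tail_image: "\<exists>r>1. bounded (tail_image r)"
proof -
  obtain R where R: "R > 1" "bounded (F ` {z. 1 < norm z \<and> norm z < R})"
    using bounded_near_circle by blast
  \<comment> \<open>Points above this level have distance at most \<open>(R - 1) / 2\<close> from \<open>c\<close>.\<close>
  define r where "r = 1 + 4 / (R - 1)"
  have r: "1 < r" using R(1) by (simp add: r_def)
  have "bounded (tail_image r)"
    unfolding tail_image_def
  proof (rule bounded_subset[OF R(2)], rule image_mono, rule subsetI)
    fix z assume "z \<in> {z \<in> disc_exterior. r < level c z}"
    then have z: "1 < norm z" "r < level c z" by auto
    have "norm (z - c) \<le> 2 / (r - 1)"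
      by (rule dist_le_of_level[OF norm_c _ r z(2)]) (use z in simp)
    also have "\<dots> = (R - 1) / 2" using R(1) by (simp add: r_def)
    finally have "norm z \<le> 1 + (R - 1) / 2" using norm_triangle_ineq2[of z c] norm_c by linarith
    then show "z \<in> {z. 1 < norm z \<and> norm z < R}" using z(1) R(1) by (simp add: field_simps)
  qed
  then show ?thesis using r by blast
qed

lemma cluster_set_eq_Inter: "cluster_set = (\<Inter>n. closure (tail_image (r + real n)))" if "1 < r"
proof (intro set_eqI iffI InterI)
  fix w assume "w \<in> (\<Inter>n. closure (tail_image (r + real n)))"
  then have w: "w \<in> closure (tail_image (r + real n))" for n by blast
  have "\<exists>z. z \<in> disc_exterior \<and> real n < level c z \<and> dist (F z) w < inverse (real (Suc n))" for n
  proof -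
    obtain x where "x \<in> tail_image (r + real n)" "dist x w < inverse (real (Suc n))"
      using w[of n] unfolding closure_approachable
      by (meson inverse_positive_iff_positive of_nat_0_less_iff zero_less_Suc)
    then show ?thesis using \<open>1 < r\<close> unfolding tail_image_def by force
  qed
  then obtain u where u: "\<And>n. u n \<in> disc_exterior" "\<And>n. real n < level c (u n)"
      "\<And>n. dist (F (u n)) w < inverse (real (Suc n))" by metis
  have "filterlim (\<lambda>n. level c (u n)) at_top sequentially"
    by (rule filterlim_at_top_mono[OF filterlim_real_sequentially])
       (use u(2) in \<open>auto intro!: always_eventually less_imp_le\<close>)
  then have "u \<longlonglongrightarrow> c" using level_at_top_iff[OF norm_c, of u] u(1) by blast
  moreover have "(\<lambda>n. F (u n)) \<longlonglongrightarrow> w"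
    by (rule metric_tendsto_imp_tendsto[OF LIMSEQ_inverse_real_of_nat])
       (use u(3) in \<open>auto intro!: always_eventually less_imp_le\<close>)
  ultimately show "w \<in> cluster_set" using u(1) unfolding cluster_set_def by blast
next
  fix w T assume "w \<in> cluster_set" and T: "T \<in> range (\<lambda>n. closure (tail_image (r + real n)))"
  obtain u where u: "\<And>n. u n \<in> disc_exterior" "u \<longlonglongrightarrow> c" "(\<lambda>n. F (u n)) \<longlonglongrightarrow> w"
    using \<open>w \<in> cluster_set\<close> by (rule cluster_setE) blast
  obtain t where t: "T = closure (tail_image t)" using T by blast
  have "\<forall>\<^sub>F n in sequentially. t < level c (u n)"
    using level_at_top_iff[OF norm_c, of u] u(1,2) by (simp add: filterlim_at_top_dense)
  then have "\<forall>\<^sub>F n in sequentially. F (u n) \<in> closure (tail_image t)"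
    by (rule eventually_mono) (use u(1) closure_subset[of "tail_image t"] in \<open>auto simp: tail_image_def\<close>)
  then show "w \<in> T"
    using u(3) unfolding t by (rule Lim_in_closed_set[OF closed_closure _ sequentially_bot])
qed

lemma connected_cluster_set: "connected cluster_set"
proof -
  obtain r where r: "1 < r" "bounded (tail_image r)" using bounded_tail_image by blast
  have "connected (\<Inter>n. closure (tail_image (r + real n)))"
  proof (rule connected_nest)
    fix n :: nat
    have "tail_image (r + real n) \<subseteq> tail_image r" unfolding tail_image_def by (intro image_mono) auto
    then show "compact (closure (tail_image (r + real n)))"
      using r(2) bounded_subset by (auto simp: compact_closure)
    have "connected {z \<in> disc_exterior. r + real n < level c z}"
      by (rule connected_superlevel[OF norm_c]) (use r(1) in linarith)
    moreover have "continuous_on {z \<in> disc_exterior. r + real n < level c z} F"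
      by (rule continuous_on_subset[OF holomorphic_on_imp_continuous_on[OF holomorphic_F]]) auto
    ultimately show "connected (closure (tail_image (r + real n)))"
      unfolding tail_image_def by (intro connected_imp_connected_closure connected_continuous_image)
  next
    fix m n :: nat assume "m \<le> n"
    then have "tail_image (r + real n) \<subseteq> tail_image (r + real m)"
      unfolding tail_image_def by (intro image_mono) auto
    then show "closure (tail_image (r + real n)) \<subseteq> closure (tail_image (r + real m))"
      by (rule closure_mono)
  qed
  then show ?thesis by (simp add: cluster_set_eq_Inter[OF r(1)])
qed

text \<open>
  Pick one point on each of a sequence of crosscuts whose levels tend to infinity and whose images
  have diameters tending to 0. If the images of these points converge along a subsequence, the
  images of the whole crosscuts converge to the same limit.
\<close>

lemma principal_point_exists:
  obtains w where "w \<in> cluster_set"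
    "\<And>\<epsilon> t. 0 < \<epsilon> \<Longrightarrow> \<exists>s>t. F ` {z \<in> disc_exterior. level c z = s} \<subseteq> cball w \<epsilon>"
proof -
  obtain r0 where r0: "1 < r0" "bounded (tail_image r0)" using bounded_tail_image by blast
  have "\<exists>r>r0 + real n. \<forall>z z'. z \<in> disc_exterior \<longrightarrow> z' \<in> disc_exterior \<longrightarrow> level c z = r \<longrightarrow> level c z' = r
      \<longrightarrow> norm (F z - F z') \<le> inverse (real (Suc n))" for n
    using short_crosscuts[OF norm_c holomorphic_F inj_F r0(2)[unfolded tail_image_def],
        of "inverse (real (Suc n))" "r0 + real n"]
    by (metis inverse_positive_iff_positive of_nat_0_less_iff zero_less_Suc)
  then obtain r where r: "\<And>n. r0 + real n < r n"
    and short: "\<And>n z z'. \<lbrakk>z \<in> disc_exterior; z' \<in> disc_exterior; level c z = r n; level c z' = r n\<rbrakk>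
      \<Longrightarrow> norm (F z - F z') \<le> inverse (real (Suc n))" by metis
  have r0r: "r0 < r n" "real n \<le> r n" for n using r[of n] r0(1) by linarith+
  have "\<exists>z. z \<in> disc_exterior \<and> level c z = r n" for n
  proof -
    have "1 < r n" using r0r(1)[of n] r0(1) by linarith
    then show ?thesis using level_set_nonempty[OF norm_c] by metis
  qed
  then obtain p where p: "\<And>n. p n \<in> disc_exterior" "\<And>n. level c (p n) = r n" by metis
  have "F (p n) \<in> closure (tail_image r0)" for n
    using p r0r(1) closure_subset[of "tail_image r0"] by (auto simp: tail_image_def)
  moreover have "seq_compact (closure (tail_image r0))"
    using r0(2) by (intro compact_imp_seq_compact) (simp add: compact_closure)
  ultimately obtain w \<sigma> where \<sigma>: "strict_mono \<sigma>" "((\<lambda>n. F (p n)) \<circ> \<sigma>) \<longlonglongrightarrow> w"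
    by (metis (no_types, lifting) seq_compactE)
  have lim\<sigma>: "(\<lambda>n. F (p (\<sigma> n))) \<longlonglongrightarrow> w" using \<sigma>(2) by (simp add: o_def)
  have rlim: "filterlim r at_top sequentially"
    by (rule filterlim_at_top_mono[OF filterlim_real_sequentially])
       (use r0r(2) in \<open>auto intro!: always_eventually\<close>)
  have r\<sigma>: "filterlim (\<lambda>n. r (\<sigma> n)) at_top sequentially"
    using filterlim_compose[OF rlim filterlim_subseq[OF \<sigma>(1)]] .
  show thesis
  proof
    have "(\<lambda>n. p (\<sigma> n)) \<longlonglongrightarrow> c"
      using level_at_top_iff[OF norm_c, of "\<lambda>n. p (\<sigma> n)"] p r\<sigma> by simp
    with lim\<sigma> p(1) show "w \<in> cluster_set"
      unfolding cluster_set_def mem_Collect_eq by (intro exI conjI allI)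
    fix \<epsilon> t :: real assume "0 < \<epsilon>"
    have "\<forall>\<^sub>F n in sequentially. dist (F (p (\<sigma> n))) w < \<epsilon> / 2"
      using lim\<sigma> by (rule tendstoD) (use \<open>0 < \<epsilon>\<close> in simp)
    moreover have "\<forall>\<^sub>F n in sequentially. inverse (real (Suc (\<sigma> n))) < \<epsilon> / 2"
    proof -
      have "(\<lambda>n. inverse (real (Suc (\<sigma> n)))) \<longlonglongrightarrow> 0"
        using LIMSEQ_subseq_LIMSEQ[OF LIMSEQ_inverse_real_of_nat \<sigma>(1)] by (simp add: o_def)
      then show ?thesis by (rule order_tendstoD) (use \<open>0 < \<epsilon>\<close> in simp)
    qed
    moreover have "\<forall>\<^sub>F n in sequentially. t < r (\<sigma> n)" using r\<sigma> by (simp add: filterlim_at_top_dense)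
    ultimately have "\<forall>\<^sub>F n in sequentially. dist (F (p (\<sigma> n))) w < \<epsilon> / 2 \<and>
        inverse (real (Suc (\<sigma> n))) < \<epsilon> / 2 \<and> t < r (\<sigma> n)" by (intro eventually_conj)
    then obtain n where n: "dist (F (p (\<sigma> n))) w < \<epsilon> / 2" "inverse (real (Suc (\<sigma> n))) < \<epsilon> / 2" "t < r (\<sigma> n)"
      using eventually_happens'[OF sequentially_bot] by blast
    have "dist w (F z) \<le> \<epsilon>" if "z \<in> disc_exterior" "level c z = r (\<sigma> n)" for z
    proof -
      have "dist (F (p (\<sigma> n))) (F z) \<le> inverse (real (Suc (\<sigma> n)))"
        unfolding dist_norm using short p that by simp
      then show ?thesis
        using n(1,2) dist_triangle3[of w "F z" "F (p (\<sigma> n))"] by linarith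
    qed
    then show "\<exists>s>t. F ` {z \<in> disc_exterior. level c z = s} \<subseteq> cball w \<epsilon>"
      using n(3) by (intro exI[of _ "r (\<sigma> n)"]) auto
  qed
qed

lemma cluster_set_subset_fiber: "\<exists>w\<in>cluster_set. cluster_set \<subseteq> fiber X w"
proof -
  obtain w where w: "w \<in> cluster_set"
    and cuts: "\<And>\<epsilon> t. 0 < \<epsilon> \<Longrightarrow> \<exists>s>t. F ` {z \<in> disc_exterior. level c z = s} \<subseteq> cball w \<epsilon>"
    by (rule principal_point_exists) blast
  obtain G where G: "continuous_on (outside X) G" "\<And>z. z \<in> disc_exterior \<Longrightarrow> G (F z) = z"
    by (rule continuous_inverse) blast
  have "cluster_set \<subseteq> pseudo_fiber X w"
  proof
    fix y assume y: "y \<in> cluster_set"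
    then obtain u where u: "\<And>n. u n \<in> disc_exterior" "u \<longlonglongrightarrow> c" "(\<lambda>n. F (u n)) \<longlonglongrightarrow> y"
      by (rule cluster_setE) blast
    have lim: "filterlim (\<lambda>n. level c (u n)) at_top sequentially"
      using level_at_top_iff[OF norm_c, of u] u(1,2) by blast
    have "\<not> separated_by X C w y" if "finite C" "C \<subseteq> X" for C
      by (rule not_separated_from_principal_point[OF compact_X frontier_X image_F G
            continuous_on_level[OF norm_c] cuts u(1) lim u(3) that])
    moreover have "y \<in> X" using y cluster_set_subset by blast
    ultimately show "y \<in> pseudo_fiber X w" by (auto simp: pseudo_fiber_def interior_X frontier_X)
  qed
  then have "cluster_set \<subseteq> fiber X w"
    unfolding fiber_def by (rule connected_component_maximal[OF w connected_cluster_set])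
  then show ?thesis using w by blast
qed

end

theorem theorem6p4:
  fixes X :: "complex set" and \<Phi> :: "ext_complex \<Rightarrow> ext_complex"
  assumes "continuum X"
    and "\<exists>x\<in>X. \<exists>y\<in>X. x \<noteq> y"
    and "unshielded X"
    and "exterior_riemann_map X \<Phi>"
  shows "\<forall>\<theta>::real. \<exists>w \<in> impression X \<Phi> \<theta>. impression X \<Phi> \<theta> \<subseteq> fiber X w"
proof
  fix \<theta> :: real
  note F = exterior_riemann_map_finite_part[OF assms(4)]
  have compact: "compact X" using assms(1) by (simp add: continuum_def)
  have frontier: "frontier (outside X) = X" using assms(3) unfolding unshielded_def by (rule sym)
  interpret exterior_map_at_boundary_point X "finite_part \<Phi>" "cis \<theta>"
    by standard (rule compact frontier F(2-5) norm_cis)+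
  have "impression X \<Phi> \<theta> = {w \<in> X. \<exists>u. (\<forall>n. u n \<in> disc_exterior) \<and> u \<longlonglongrightarrow> cis \<theta> \<and>
      (\<lambda>n. finite_part \<Phi> (u n)) \<longlonglongrightarrow> w}"
    by (rule impression_eq_cluster_set) (use F(1) in blast)
  then have "impression X \<Phi> \<theta> = cluster_set"
    using cluster_set_subset unfolding cluster_set_def by blast
  then show "\<exists>w \<in> impression X \<Phi> \<theta>. impression X \<Phi> \<theta> \<subseteq> fiber X w"
    using cluster_set_subset_fiber by simp
qed

end
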